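(* Let $T$ be an invertible $3$-D Toeplitz matrix, and let $u_p,\widehat u_p$ $(p=1,2)$, $G(\lambda)$ with blocks $G_{12},G_{21}$, $q$ and $\widetilde U_k$ be as in the context. Then $$u_p(\mu)=-q(\mu)\,U_3\,\widehat u_p(\mu)^{\tau}\,\widetilde U_k\qquad(k,p\in\{1,2\},\ k\neq p)$$ for all $\mu=(\mu_1,\mu_2)\in\mathbb C^2$ with $\mu_1,\mu_2\notin\{\mathrm i/2,-\mathrm i/2\}$. The matrix function $G(\lambda)$ is determined by its block $G_{12}$, and $$G_{21}=\widetilde U_1\,G_{12}^{\tau}\,\widetilde U_2 .$$
   Context: Notation: $I_r$ is the $r\times r$ identity, $I=I_m$; $\otimes$ is the Kronecker product; ${}^*$ is the conjugate transpose and ${}^\tau$ the (non-conjugate) transpose; $\mathrm{col}[\dots]$ stacks blocks into a (block) column; $\mathbf 1_r$ is the $r\times1$ column of ones. Fix integers $m_1,m_2,m_3\ge2$ and put $m=m_1m_2m_3$. A $3$-D Toeplitz matrix is an $m\times m$ matrix $T=\{\mathcal T_{i-k}\}_{i,k=1}^{m_1}$, where $\mathcal T_r=\{t^{(r)}_{i-k}\}_{i,k=1}^{m_2}$, $t^{(r)}_s=\{\tau^{(r,s)}_{i-k}\}_{i,k=1}^{m_3}$ and $\tau^{(r,s)}_{\ell}\in\mathbb C$. Let $U_p=\{\delta_{m_p-i-k+1}\}_{i,k=1}^{m_p}$ $(p=1,2,3)$, $\delta_s$ being the Kronecker delta ($\delta_0=1$, $\delta_s=0$ for $s\ne0$), so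 $U_p$ has ones on the antidiagonal and zeros elsewhere. For $k=1,2$ let $$\widetilde U_k=\begin{bmatrix}0&-U_k\otimes U_3 \\ U_k\otimes U_3&0\end{bmatrix},\qquad q(\mu)=\left(\frac{\mu_1-\frac{\mathrm i}2}{\mu_1+\frac{\mathrm i}2}\right)^{m_1}\left(\frac{\mu_2-\frac{\mathrm i}2}{\mu_2+\frac{\mathrm i}2}\right)^{m_2}.$$ Let $\mathcal A_p=\{a_{j-\ell}\}_{j,\ell=1}^{m_p}$ with $a_r=0$ for $r<0$, $a_0=\mathrm i/2$, $a_r=\mathrm i$ for $r>0$, and $A_1=\mathcal A_1\otimes I_{m_2}\otimes I_{m_3}$, $A_2=I_{m_1}\otimes\mathcal A_2\otimes I_{m_3}$ (these commute). Let $\mathcal L=\mathbf 1_{m_1m_2}\otimes I_{m_3}$ and $\mathcal L_p=\mathbf 1_{m_p}\otimes I_{m_3}$ $(p=1,2)$. Define $M_{11}=\mathrm{col}[M_{11}^{(1)},\dots,M_{11}^{(m_1)}]$, $M_{11}^{(i)}=\tfrac12\mathcal T_0+\sum_{s=1}^{i-1}\mathcal T_s$; $M_{21}=\mathbf 1_{m_1}^*\otimes I_{m_2m_3}$; $M_{31}=M_{21}^*$; $M_{41}=[M_{41}^{(1)}\ \dots\ M_{41}^{(m_1)}]$, $M_{41}^{(k)}=\tfrac12\mathcal T_0+\sum_{s=1}^{k-1}\mathcal T_{-s}$; $M_{12}=\{M_{12}^{(i-k)}\}_{i,k=1}^{m_1}$, where $M_{12}^{(r)}$ is the block column with $i$-th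 block $\tfrac12t_0^{(r)}+\sum_{j=1}^{i-1}t_j^{(r)}$ $(1\le i\le m_2)$; $M_{22}=I_{m_1}\otimes\mathbf 1_{m_2}^*\otimes I_{m_3}$; $M_{32}=M_{22}^*$; $M_{42}=\{M_{42}^{(i-k)}\}_{i,k=1}^{m_1}$, where $M_{42}^{(r)}$ is the block row with $k$-th block $\tfrac12t_0^{(r)}+\sum_{\ell=1}^{k-1}t_{-\ell}^{(r)}$ $(1\le k\le m_2)$. For invertible $T$ and $p=1,2$ put $R=T^{-1}$, $\Pi_p=[M_{1p}\ M_{3p}]$, $\widehat\Pi_p=\begin{bmatrix}M_{2p} \\ M_{4p}\end{bmatrix}$, $\Gamma_p=R\Pi_p$, $\widehat\Gamma_p=\widehat\Pi_pR$. Define $$v_p(\mu)=\mathcal L^*\Big(\prod_{i=1}^2(A_i^*-\mu_iI)^{-1}\Big)\Gamma_p,\qquad \widehat v_p(\lambda)=\widehat\Gamma_p\Big(\prod_{i=1}^2(A_i-\lambda_iI)^{-1}\Big)\mathcal L,$$ and, for $\{k,p\}=\{1,2\}$, $$u_p(\mu)=v_p(\mu)-\mathrm i\big(\mathbf 1_{m_k}^*(\mathcal A_k^*-\mu_kI_{m_k})^{-1}\otimes I_{m_3}\big)\begin{bmatrix}I_{m_km_3}&0\end{bmatrix},$$ $$\widehat u_p(\lambda)=\widehat v_p(\lambda)+\mathrm i\begin{bmatrix}0 \\ I_{m_km_3}\end{bmatrix}\big((\mathcal A_k-\lambda_kI_{m_k})^{-1}\mathbf 1_{m_k}\otimes I_{m_3}\big),$$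 where the zero blocks are square of order $m_km_3$. Define further $K_{11}$ = block column with $i$-th block $\tfrac12M_{42}^{(0)}+\sum_{j=1}^{i-1}M_{42}^{(j)}$ $(1\le i\le m_1)$; $K_{12}$ = block row with $k$-th block $\tfrac12M_{12}^{(0)}+\sum_{j=1}^{k-1}M_{12}^{(-j)}$ $(1\le k\le m_1)$; $$G(\lambda)=\begin{bmatrix}G_{11}(\lambda_2)&G_{12} \\ G_{21}&G_{22}(\lambda_1)\end{bmatrix},\quad G_{11}(\lambda_2)=I_2\otimes(\mathcal A_2-\lambda_2I_{m_2})\otimes I_{m_3},\quad G_{22}(\lambda_1)=I_2\otimes(\mathcal A_1-\lambda_1I_{m_1})\otimes I_{m_3},$$ $$G_{21}=\mathrm i\left(\widehat\Pi_2\Gamma_1-\begin{bmatrix}\mathcal L_1\mathcal L_2^*&0 \\ K_{11}&0\end{bmatrix}\right),\qquad G_{12}=\mathrm i\left(\widehat\Pi_1\Gamma_2-\begin{bmatrix}\mathcal L_2\mathcal L_1^*&0 \\ K_{12}&0\end{bmatrix}\right).$$ Note that $G_{11}(\lambda_2)$ and $G_{22}(\lambda_1)$ do not depend on the entries of $T$; "determined by $G_{12}$" means that, for given $m_1,m_2,m_3$, $G(\lambda)$ is a function of $G_{12}$ only. *)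

theory Defs
  imports Complex_Main
    "Jordan_Normal_Form.Gauss_Jordan_Elimination"
    "Jordan_Normal_Form.Schur_Decomposition"
begin

(* Matrices of type "complex mat" are indexed from 0, whereas the mathematical text indexes from 1.
   Toeplitz structures depend on index differences only and are unaffected; elsewhere the shift is
   pointed out. The sizes m_1, m_2, m_3 are the values m 1, m 2, m 3 of a function m, and a point
   (x_1, x_2) of C^2 is given by the values x 1, x 2 of a function x :: nat => complex. *)

section \<open>General matrix operations\<close>

definition mat_inv :: "complex mat \<Rightarrow> complex mat" where
  "mat_inv A = the (mat_inverse A)"

lemma mat_inv_invertible:
  assumes "invertible_mat A" "A \<in> carrier_mat n n"
  shows "mat_inv A \<in> carrier_mat n n" "A * mat_inv A = 1\<^sub>m n" "mat_inv A * A = 1\<^sub>m n"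
proof -
  from assms obtain B where "A * B = 1\<^sub>m n" "B * A = 1\<^sub>m (dim_row B)"
    unfolding invertible_mat_def inverts_mat_def by auto
  moreover from this have "B \<in> carrier_mat n n"
    using assms(2) by (metis carrier_matD(2) carrier_matI index_mult_mat(3) index_one_mat(3))
  ultimately have "A \<in> Units (ring_mat TYPE(complex) n ())"
    using assms(2) by (auto simp: Units_def ring_mat_def)
  then obtain C where "mat_inverse A = Some C"
    using mat_inverse(1)[OF assms(2), where b = "()"] by (cases "mat_inverse A") auto
  then show "mat_inv A \<in> carrier_mat n n" "A * mat_inv A = 1\<^sub>m n" "mat_inv A * A = 1\<^sub>m n"
    using mat_inverse(2)[OF assms(2)] by (auto simp: mat_inv_def)
qed

definition kronecker :: "complex mat \<Rightarrow> complex mat \<Rightarrow> complex mat" (infixr \<open>\<otimes>\<^sub>K\<close> 75) where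
  "A \<otimes>\<^sub>K B = mat (dim_row A * dim_row B) (dim_col A * dim_col B)
     (\<lambda>(i, j). A $$ (i div dim_row B, j div dim_col B) * B $$ (i mod dim_row B, j mod dim_col B))"

(* the horizontal counterpart of the library's append_rows *)
definition append_cols :: "complex mat \<Rightarrow> complex mat \<Rightarrow> complex mat" (infixr \<open>@\<^sub>c\<close> 65) where
  "A @\<^sub>c B = four_block_mat A B (0\<^sub>m 0 (dim_col A)) (0\<^sub>m 0 (dim_col B))"

(* nr x nc blocks F i k, each of size r x c *)
definition block_mat :: "nat \<Rightarrow> nat \<Rightarrow> nat \<Rightarrow> nat \<Rightarrow> (nat \<Rightarrow> nat \<Rightarrow> complex mat) \<Rightarrow> complex mat" where
  "block_mat nr nc r c F =
     mat (nr * r) (nc * c) (\<lambda>(i, j). F (i div r) (j div c) $$ (i mod r, j mod c))"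

definition block_toeplitz :: "nat \<Rightarrow> nat \<Rightarrow> nat \<Rightarrow> (int \<Rightarrow> complex mat) \<Rightarrow> complex mat" where
  "block_toeplitz n r c X = block_mat n n r c (\<lambda>i k. X (int i - int k))"

definition block_col :: "nat \<Rightarrow> nat \<Rightarrow> nat \<Rightarrow> (nat \<Rightarrow> complex mat) \<Rightarrow> complex mat" where
  "block_col n r c X = block_mat n 1 r c (\<lambda>i _. X i)"

definition block_row :: "nat \<Rightarrow> nat \<Rightarrow> nat \<Rightarrow> (nat \<Rightarrow> complex mat) \<Rightarrow> complex mat" where
  "block_row n r c X = block_mat 1 n r c (\<lambda>_ k. X k)"

(* half_sum X i = X_0 / 2 + X_1 + ... + X_i; this is the block number i + 1 of the block columns
   and rows below when blocks are counted from 1 *)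
primrec half_sum :: "(nat \<Rightarrow> complex mat) \<Rightarrow> nat \<Rightarrow> complex mat" where
  "half_sum X 0 = (1/2) \<cdot>\<^sub>m X 0"
| "half_sum X (Suc i) = half_sum X i + X (Suc i)"

definition ones_col :: "nat \<Rightarrow> complex mat" where
  "ones_col r = mat r 1 (\<lambda>_. 1)"

section \<open>Toeplitz matrices with a three-level structure\<close>

definition toep_inner :: "(nat \<Rightarrow> nat) \<Rightarrow> (int \<Rightarrow> int \<Rightarrow> int \<Rightarrow> complex) \<Rightarrow> int \<Rightarrow> int \<Rightarrow> complex mat" where
  "toep_inner m \<tau> r s = mat (m 3) (m 3) (\<lambda>(i, k). \<tau> r s (int i - int k))"

definition toep_middle :: "(nat \<Rightarrow> nat) \<Rightarrow> (int \<Rightarrow> int \<Rightarrow> int \<Rightarrow> complex) \<Rightarrow> int \<Rightarrow> complex mat" where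
  "toep_middle m \<tau> r = block_toeplitz (m 2) (m 3) (m 3) (toep_inner m \<tau> r)"

definition toeplitz3 :: "(nat \<Rightarrow> nat) \<Rightarrow> (int \<Rightarrow> int \<Rightarrow> int \<Rightarrow> complex) \<Rightarrow> complex mat" where
  "toeplitz3 m \<tau> = block_toeplitz (m 1) (m 2 * m 3) (m 2 * m 3) (toep_middle m \<tau>)"

section \<open>Matrices that do not depend on the Toeplitz entries\<close>

(* 1-based i + k = m_p + 1 becomes 0-based i + k + 1 = m_p *)
definition U :: "(nat \<Rightarrow> nat) \<Rightarrow> nat \<Rightarrow> complex mat" where
  "U m p = mat (m p) (m p) (\<lambda>(i, k). if i + k + 1 = m p then 1 else 0)"

definition Utilde :: "(nat \<Rightarrow> nat) \<Rightarrow> nat \<Rightarrow> complex mat" where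
  "Utilde m k = four_block_mat
     (0\<^sub>m (m k * m 3) (m k * m 3)) (- (U m k \<otimes>\<^sub>K U m 3))
     (U m k \<otimes>\<^sub>K U m 3)           (0\<^sub>m (m k * m 3) (m k * m 3))"

definition q :: "(nat \<Rightarrow> nat) \<Rightarrow> (nat \<Rightarrow> complex) \<Rightarrow> complex" where
  "q m \<mu> = ((\<mu> 1 - \<i>/2) / (\<mu> 1 + \<i>/2)) ^ m 1 * ((\<mu> 2 - \<i>/2) / (\<mu> 2 + \<i>/2)) ^ m 2"

definition A_cal :: "(nat \<Rightarrow> nat) \<Rightarrow> nat \<Rightarrow> complex mat" where
  "A_cal m p = mat (m p) (m p) (\<lambda>(j, l). if j < l then 0 else if j = l then \<i>/2 else \<i>)"

definition A1 :: "(nat \<Rightarrow> nat) \<Rightarrow> complex mat" where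
  "A1 m = A_cal m 1 \<otimes>\<^sub>K 1\<^sub>m (m 2) \<otimes>\<^sub>K 1\<^sub>m (m 3)"

definition A2 :: "(nat \<Rightarrow> nat) \<Rightarrow> complex mat" where
  "A2 m = 1\<^sub>m (m 1) \<otimes>\<^sub>K A_cal m 2 \<otimes>\<^sub>K 1\<^sub>m (m 3)"

definition L :: "(nat \<Rightarrow> nat) \<Rightarrow> complex mat" where
  "L m = ones_col (m 1 * m 2) \<otimes>\<^sub>K 1\<^sub>m (m 3)"

definition Lp :: "(nat \<Rightarrow> nat) \<Rightarrow> nat \<Rightarrow> complex mat" where
  "Lp m p = ones_col (m p) \<otimes>\<^sub>K 1\<^sub>m (m 3)"

section \<open>The matrices $M_{ij}$, $\Pi_p$ and $\Gamma_p$\<close>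

definition M11 :: "(nat \<Rightarrow> nat) \<Rightarrow> (int \<Rightarrow> int \<Rightarrow> int \<Rightarrow> complex) \<Rightarrow> complex mat" where
  "M11 m \<tau> = block_col (m 1) (m 2 * m 3) (m 2 * m 3) (half_sum (\<lambda>s. toep_middle m \<tau> (int s)))"

definition M21 :: "(nat \<Rightarrow> nat) \<Rightarrow> complex mat" where
  "M21 m = mat_adjoint (ones_col (m 1)) \<otimes>\<^sub>K 1\<^sub>m (m 2 * m 3)"

definition M31 :: "(nat \<Rightarrow> nat) \<Rightarrow> complex mat" where
  "M31 m = mat_adjoint (M21 m)"

definition M41 :: "(nat \<Rightarrow> nat) \<Rightarrow> (int \<Rightarrow> int \<Rightarrow> int \<Rightarrow> complex) \<Rightarrow> complex mat" where
  "M41 m \<tau> = block_row (m 1) (m 2 * m 3) (m 2 * m 3) (half_sum (\<lambda>s. toep_middle m \<tau> (- int s)))"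

definition M12_block :: "(nat \<Rightarrow> nat) \<Rightarrow> (int \<Rightarrow> int \<Rightarrow> int \<Rightarrow> complex) \<Rightarrow> int \<Rightarrow> complex mat" where
  "M12_block m \<tau> r = block_col (m 2) (m 3) (m 3) (half_sum (\<lambda>s. toep_inner m \<tau> r (int s)))"

definition M12 :: "(nat \<Rightarrow> nat) \<Rightarrow> (int \<Rightarrow> int \<Rightarrow> int \<Rightarrow> complex) \<Rightarrow> complex mat" where
  "M12 m \<tau> = block_toeplitz (m 1) (m 2 * m 3) (m 3) (M12_block m \<tau>)"

definition M22 :: "(nat \<Rightarrow> nat) \<Rightarrow> complex mat" where
  "M22 m = 1\<^sub>m (m 1) \<otimes>\<^sub>K mat_adjoint (ones_col (m 2)) \<otimes>\<^sub>K 1\<^sub>m (m 3)"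

definition M32 :: "(nat \<Rightarrow> nat) \<Rightarrow> complex mat" where
  "M32 m = mat_adjoint (M22 m)"

definition M42_block :: "(nat \<Rightarrow> nat) \<Rightarrow> (int \<Rightarrow> int \<Rightarrow> int \<Rightarrow> complex) \<Rightarrow> int \<Rightarrow> complex mat" where
  "M42_block m \<tau> r = block_row (m 2) (m 3) (m 3) (half_sum (\<lambda>s. toep_inner m \<tau> r (- int s)))"

definition M42 :: "(nat \<Rightarrow> nat) \<Rightarrow> (int \<Rightarrow> int \<Rightarrow> int \<Rightarrow> complex) \<Rightarrow> complex mat" where
  "M42 m \<tau> = block_toeplitz (m 1) (m 3) (m 2 * m 3) (M42_block m \<tau>)"

(* The index p ranges over {1, 2} here and below. *)
definition Pi_mat :: "(nat \<Rightarrow> nat) \<Rightarrow> (int \<Rightarrow> int \<Rightarrow> int \<Rightarrow> complex) \<Rightarrow> nat \<Rightarrow> complex mat" where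
  "Pi_mat m \<tau> p = (if p = 1 then M11 m \<tau> @\<^sub>c M31 m else M12 m \<tau> @\<^sub>c M32 m)"

definition Pi_hat :: "(nat \<Rightarrow> nat) \<Rightarrow> (int \<Rightarrow> int \<Rightarrow> int \<Rightarrow> complex) \<Rightarrow> nat \<Rightarrow> complex mat" where
  "Pi_hat m \<tau> p = (if p = 1 then M21 m @\<^sub>r M41 m \<tau> else M22 m @\<^sub>r M42 m \<tau>)"

definition Gam :: "(nat \<Rightarrow> nat) \<Rightarrow> (int \<Rightarrow> int \<Rightarrow> int \<Rightarrow> complex) \<Rightarrow> nat \<Rightarrow> complex mat" where
  "Gam m \<tau> p = mat_inv (toeplitz3 m \<tau>) * Pi_mat m \<tau> p"

definition Gam_hat :: "(nat \<Rightarrow> nat) \<Rightarrow> (int \<Rightarrow> int \<Rightarrow> int \<Rightarrow> complex) \<Rightarrow> nat \<Rightarrow> complex mat" where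
  "Gam_hat m \<tau> p = Pi_hat m \<tau> p * mat_inv (toeplitz3 m \<tau>)"

section \<open>The functions $u_p$ and $G$\<close>

definition v :: "(nat \<Rightarrow> nat) \<Rightarrow> (int \<Rightarrow> int \<Rightarrow> int \<Rightarrow> complex) \<Rightarrow> nat \<Rightarrow> (nat \<Rightarrow> complex) \<Rightarrow> complex mat" where
  "v m \<tau> p \<mu> = (let I = 1\<^sub>m (m 1 * m 2 * m 3) in
     mat_adjoint (L m)
     * (mat_inv (mat_adjoint (A1 m) - \<mu> 1 \<cdot>\<^sub>m I) * mat_inv (mat_adjoint (A2 m) - \<mu> 2 \<cdot>\<^sub>m I))
     * Gam m \<tau> p)"

definition v_hat :: "(nat \<Rightarrow> nat) \<Rightarrow> (int \<Rightarrow> int \<Rightarrow> int \<Rightarrow> complex) \<Rightarrow> nat \<Rightarrow> (nat \<Rightarrow> complex) \<Rightarrow> complex mat" where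
  "v_hat m \<tau> p \<mu> = (let I = 1\<^sub>m (m 1 * m 2 * m 3) in
     Gam_hat m \<tau> p
     * (mat_inv (A1 m - \<mu> 1 \<cdot>\<^sub>m I) * mat_inv (A2 m - \<mu> 2 \<cdot>\<^sub>m I))
     * L m)"

(* k = 3 - p is the index complementary to p in {1, 2} *)
definition u :: "(nat \<Rightarrow> nat) \<Rightarrow> (int \<Rightarrow> int \<Rightarrow> int \<Rightarrow> complex) \<Rightarrow> nat \<Rightarrow> (nat \<Rightarrow> complex) \<Rightarrow> complex mat" where
  "u m \<tau> p \<mu> = (let k = 3 - p; N = m k * m 3 in
     v m \<tau> p \<mu>
     - \<i> \<cdot>\<^sub>m (((mat_adjoint (ones_col (m k)) * mat_inv (mat_adjoint (A_cal m k) - \<mu> k \<cdot>\<^sub>m 1\<^sub>m (m k)))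
               \<otimes>\<^sub>K 1\<^sub>m (m 3))
             * (1\<^sub>m N @\<^sub>c 0\<^sub>m N N)))"

definition u_hat :: "(nat \<Rightarrow> nat) \<Rightarrow> (int \<Rightarrow> int \<Rightarrow> int \<Rightarrow> complex) \<Rightarrow> nat \<Rightarrow> (nat \<Rightarrow> complex) \<Rightarrow> complex mat" where
  "u_hat m \<tau> p \<mu> = (let k = 3 - p; N = m k * m 3 in
     v_hat m \<tau> p \<mu>
     + \<i> \<cdot>\<^sub>m ((0\<^sub>m N N @\<^sub>r 1\<^sub>m N)
             * ((mat_inv (A_cal m k - \<mu> k \<cdot>\<^sub>m 1\<^sub>m (m k)) * ones_col (m k)) \<otimes>\<^sub>K 1\<^sub>m (m 3))))"

definition K11 :: "(nat \<Rightarrow> nat) \<Rightarrow> (int \<Rightarrow> int \<Rightarrow> int \<Rightarrow> complex) \<Rightarrow> complex mat" where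
  "K11 m \<tau> = block_col (m 1) (m 3) (m 2 * m 3) (half_sum (\<lambda>j. M42_block m \<tau> (int j)))"

definition K12 :: "(nat \<Rightarrow> nat) \<Rightarrow> (int \<Rightarrow> int \<Rightarrow> int \<Rightarrow> complex) \<Rightarrow> complex mat" where
  "K12 m \<tau> = block_row (m 1) (m 2 * m 3) (m 3) (half_sum (\<lambda>j. M12_block m \<tau> (- int j)))"

definition G11 :: "(nat \<Rightarrow> nat) \<Rightarrow> (nat \<Rightarrow> complex) \<Rightarrow> complex mat" where
  "G11 m \<mu> = 1\<^sub>m 2 \<otimes>\<^sub>K (A_cal m 2 - \<mu> 2 \<cdot>\<^sub>m 1\<^sub>m (m 2)) \<otimes>\<^sub>K 1\<^sub>m (m 3)"

definition G22 :: "(nat \<Rightarrow> nat) \<Rightarrow> (nat \<Rightarrow> complex) \<Rightarrow> complex mat" where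
  "G22 m \<mu> = 1\<^sub>m 2 \<otimes>\<^sub>K (A_cal m 1 - \<mu> 1 \<cdot>\<^sub>m 1\<^sub>m (m 1)) \<otimes>\<^sub>K 1\<^sub>m (m 3)"

definition G21 :: "(nat \<Rightarrow> nat) \<Rightarrow> (int \<Rightarrow> int \<Rightarrow> int \<Rightarrow> complex) \<Rightarrow> complex mat" where
  "G21 m \<tau> = (let Z = 0\<^sub>m (m 1 * m 3) (m 2 * m 3) in
     \<i> \<cdot>\<^sub>m (Pi_hat m \<tau> 2 * Gam m \<tau> 1
           - four_block_mat (Lp m 1 * mat_adjoint (Lp m 2)) Z
                            (K11 m \<tau>)                       Z))"

definition G12 :: "(nat \<Rightarrow> nat) \<Rightarrow> (int \<Rightarrow> int \<Rightarrow> int \<Rightarrow> complex) \<Rightarrow> complex mat" where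
  "G12 m \<tau> = (let Z = 0\<^sub>m (m 2 * m 3) (m 1 * m 3) in
     \<i> \<cdot>\<^sub>m (Pi_hat m \<tau> 1 * Gam m \<tau> 2
           - four_block_mat (Lp m 2 * mat_adjoint (Lp m 1)) Z
                            (K12 m \<tau>)                       Z))"

definition G :: "(nat \<Rightarrow> nat) \<Rightarrow> (int \<Rightarrow> int \<Rightarrow> int \<Rightarrow> complex) \<Rightarrow> (nat \<Rightarrow> complex) \<Rightarrow> complex mat" where
  "G m \<tau> \<mu> = four_block_mat (G11 m \<mu>) (G12 m \<tau>) (G21 m \<tau>) (G22 m \<mu>)"

end

theory Submission
  imports Defs
begin

text \<open>
  Write \<open>J\<close> for an exchange matrix (ones on the antidiagonal) and \<open>flip A = J A\<^sup>T J\<close> for the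
  reflection of a matrix in its antidiagonal. Like transposition, \<open>flip\<close> reverses products and
  commutes with inversion; unlike transposition, it fixes every multilevel Toeplitz matrix, hence \<open>T\<close>,
  \<open>R = T\<^sup>-\<^sup>1\<close>, the lower triangular matrices \<open>A_p\<close> and their resolvents. It acts factor by factor on
  Kronecker products and turns a column of ones into a row of ones, so it exchanges \<open>M_3p\<close> and
  \<open>M_2p\<close>. Finally \<open>U_3 [P; Q]\<^sup>T Utilde_k = [flip Q, - flip P]\<close>: multiplication by \<open>Utilde_k\<close> turns
  transposes into reflections, interchanges the two blocks and changes one sign. Both formulas of
  the corollary are therefore statements about reflections.

  One fact about the data carries the proof. Summing a row of a Toeplitz matrix over all columns
  gives the half sum over the nonnegative differences up to the row index plus the half sum over the
  nonpositive ones, each of the two taking half of the diagonal entry. In block form this reads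
  \<open>T M_3p = M_1p + flip M_4p\<close> (lemmas \<open>toeplitz3_mult_M31\<close> and \<open>toeplitz3_mult_M32\<close>). After multiplication
  by \<open>R\<close> it becomes \<open>R (flip M_4p) = M_3p - R M_1p\<close>: up to the explicit matrix \<open>M_2p\<close>, the second
  block of \<open>Gam_hat\<close> is the reflection of minus the first block of \<open>Gam\<close>, while the first block of
  \<open>Gam_hat\<close> is the reflection of the second block of \<open>Gam\<close>.

  For \<open>u_p\<close> there remains the difference between the resolvents of \<open>A_p\<^sup>*\<close> and \<open>A_p\<close>. Since
  \<open>A_p\<^sup>* = A_p - \<i> 1 1\<^sup>*\<close> is a perturbation of rank one, the row \<open>1\<^sup>* (A_p\<^sup>* - z)\<^sup>-\<^sup>1\<close> is a multiple of
  \<open>1\<^sup>* (A_p - z)\<^sup>-\<^sup>1\<close>, and solving the triangular system \<open>(A_p - z) y = 1\<close>, whose solution is a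
  geometric progression, shows that the factor is the \<open>p\<close>-th factor of \<open>q\<close>
  (lemma \<open>adjoint_resolvent_row\<close>). The summand of \<open>u_p\<close> that does not involve \<open>T\<close> is exactly what
  absorbs the term \<open>M_3p\<close> (lemma \<open>u_reflection_core\<close>).

  For \<open>G\<close>, the four blocks of \<open>G_12\<close> are reflected separately. Three of them need only the relations
  above; the fourth contains \<open>K_11\<close> and \<open>K_12\<close>, which arise from half sums in both outer
  directions. Applying the row sum formula once in each direction shows that \<open>M_42 M_31 - K_11\<close> is
  the reflection of \<open>M_41 M_32 - K_12\<close> (lemma \<open>K11_decomposition\<close>), and this makes the remaining
  terms cancel. Since \<open>G_21\<close> is then a function of \<open>G_12\<close>, so is \<open>G\<close>.
\<close>

section \<open>The antitranspose\<close>

text \<open>The matrix \<open>J A\<^sup>T J\<close> with \<open>J\<close> the exchange matrices of the fitting sizes (lemma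
\<open>flip_eq_exchange\<close>), defined on entries so that the sizes need not be mentioned.\<close>

definition flip :: "complex mat \<Rightarrow> complex mat" where
  "flip A = mat (dim_col A) (dim_row A)
     (\<lambda>(i, j). A $$ (dim_row A - 1 - j, dim_col A - 1 - i))"

lemma flip_carrier [simp]: "A \<in> carrier_mat a b \<Longrightarrow> flip A \<in> carrier_mat b a"
  by (auto simp: flip_def)

lemma dim_flip [simp]: "dim_row (flip A) = dim_col A" "dim_col (flip A) = dim_row A"
  by (auto simp: flip_def)

lemma flip_flip [simp]: "flip (flip A) = A"
  by (rule eq_matI) (auto simp: flip_def)

lemma flip_one [simp]: "flip (1\<^sub>m a) = 1\<^sub>m a"
  by (rule eq_matI) (auto simp: flip_def)

lemma flip_add:
  assumes "A \<in> carrier_mat a b" "B \<in> carrier_mat a b"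
  shows "flip (A + B) = flip A + flip B"
  using assms by (intro eq_matI) (auto simp: flip_def)

lemma flip_minus:
  assumes "A \<in> carrier_mat a b" "B \<in> carrier_mat a b"
  shows "flip (A - B) = flip A - flip B"
  using assms by (intro eq_matI) (auto simp: flip_def)

lemma flip_smult: "flip (s \<cdot>\<^sub>m A) = s \<cdot>\<^sub>m flip A"
  by (rule eq_matI) (auto simp: flip_def)

lemma flip_mult:
  assumes "A \<in> carrier_mat a b" "B \<in> carrier_mat b c"
  shows "flip (A * B) = flip B * flip A"
proof (rule eq_matI)
  fix i j assume "i < dim_row (flip B * flip A)" "j < dim_col (flip B * flip A)"
  with assms have ij: "i < c" "j < a" by auto
  have "flip (A * B) $$ (i, j) = (\<Sum>k<b. A $$ (a - 1 - j, k) * B $$ (k, c - 1 - i))"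
    using ij assms by (auto simp: flip_def scalar_prod_def lessThan_atLeast0)
  also have "\<dots> = (\<Sum>k<b. B $$ (b - 1 - k, c - 1 - i) * A $$ (a - 1 - j, b - 1 - k))"
    by (rule sum.reindex_bij_witness[of _ "\<lambda>k. b - 1 - k" "\<lambda>k. b - 1 - k"]) auto
  also have "\<dots> = (flip B * flip A) $$ (i, j)"
    using ij assms by (auto simp: flip_def scalar_prod_def lessThan_atLeast0)
  finally show "flip (A * B) $$ (i, j) = (flip B * flip A) $$ (i, j)" .
qed (use assms in auto)

text \<open>Reversing the order of \<open>a * b\<close> indices reverses both the block index and the index inside the
block. This is why \<open>flip\<close> respects Kronecker products and partitions into blocks.\<close>

lemma reverse_index:
  assumes "i < a * (b::nat)"
  shows "(a * b - Suc i) div b = a - Suc (i div b)" "(a * b - Suc i) mod b = b - Suc (i mod b)"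
proof -
  have b: "b > 0" using assms by (cases b) auto
  have lt: "i div b < a" using assms by (simp add: less_mult_imp_div_less)
  have "a * b - Suc i = (a - Suc (i div b)) * b + (b - Suc (i mod b))"
  proof -
    have "i = i div b * b + i mod b" by simp
    moreover have "a * b = (a - Suc (i div b)) * b + i div b * b + b"
    proof -
      obtain c where "a = Suc (i div b + c)" using lt less_imp_Suc_add by blast
      then show ?thesis by (simp add: algebra_simps)
    qed
    moreover have "i mod b < b" using b by simp
    ultimately show ?thesis by linarith
  qed
  then show "(a * b - Suc i) div b = a - Suc (i div b)" "(a * b - Suc i) mod b = b - Suc (i mod b)"
    using b by simp_all
qed

section \<open>Kronecker products\<close>

lemma dim_kronecker [simp]:
  "dim_row (A \<otimes>\<^sub>K B) = dim_row A * dim_row B" "dim_col (A \<otimes>\<^sub>K B) = dim_col A * dim_col B"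
  by (auto simp: kronecker_def)

lemma kronecker_carrier [simp]:
  "A \<in> carrier_mat a b \<Longrightarrow> B \<in> carrier_mat c d \<Longrightarrow> A \<otimes>\<^sub>K B \<in> carrier_mat (a * c) (b * d)"
  by auto

lemma kronecker_index:
  assumes "i < dim_row A * dim_row B" "j < dim_col A * dim_col B"
  shows "(A \<otimes>\<^sub>K B) $$ (i, j) =
    A $$ (i div dim_row B, j div dim_col B) * B $$ (i mod dim_row B, j mod dim_col B)"
  using assms by (simp add: kronecker_def)

lemma div_mod_less:
  assumes "i < a * (b::nat)"
  shows "i div b < a" "i mod b < b" "b > 0"
  using assms by (auto simp: less_mult_imp_div_less intro!: mod_less_divisor) (cases b; auto)+

lemma flip_kronecker: "flip (A \<otimes>\<^sub>K B) = flip A \<otimes>\<^sub>K flip B"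
proof (rule eq_matI)
  fix i j assume "i < dim_row (flip A \<otimes>\<^sub>K flip B)" "j < dim_col (flip A \<otimes>\<^sub>K flip B)"
  then have ij: "i < dim_col A * dim_col B" "j < dim_row A * dim_row B" by auto
  from ij show "flip (A \<otimes>\<^sub>K B) $$ (i, j) = (flip A \<otimes>\<^sub>K flip B) $$ (i, j)"
    by (auto simp: flip_def kronecker_index reverse_index div_mod_less)
qed auto

lemma sum_div_mod:
  "(\<Sum>k<a * (b::nat). f (k div b) (k mod b)) = (\<Sum>x<a. \<Sum>y<b. (f x y :: complex))"
proof -
  have "(\<Sum>k<a * b. f (k div b) (k mod b)) = (\<Sum>(x, y)\<in>{..<a} \<times> {..<b}. f x y)"
  proof (rule sum.reindex_bij_witness[of _ "\<lambda>(x, y). x * b + y" "\<lambda>k. (k div b, k mod b)"])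
    fix z assume "z \<in> {..<a} \<times> {..<b}"
    then obtain x y where z: "z = (x, y)" "x < a" "y < b" by auto
    have "x * b + y < Suc x * b" using z by simp
    also have "\<dots> \<le> a * b" using z by (intro mult_le_mono1) simp
    finally show "(case z of (x, y) \<Rightarrow> x * b + y) \<in> {..<a * b}" using z by simp
  qed (auto simp: div_mod_less)
  then show ?thesis by (simp add: sum.cartesian_product)
qed

lemma kronecker_mult:
  assumes "A \<in> carrier_mat a b" "C \<in> carrier_mat b c" "B \<in> carrier_mat d e" "D \<in> carrier_mat e f"
  shows "(A \<otimes>\<^sub>K B) * (C \<otimes>\<^sub>K D) = (A * C) \<otimes>\<^sub>K (B * D)"
proof (rule eq_matI)
  fix i j assume "i < dim_row ((A * C) \<otimes>\<^sub>K (B * D))" "j < dim_col ((A * C) \<otimes>\<^sub>K (B * D))"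
  with assms have ij: "i < a * d" "j < c * f" by auto
  note ij' = div_mod_less[OF ij(1)] div_mod_less[OF ij(2)]
  have "((A \<otimes>\<^sub>K B) * (C \<otimes>\<^sub>K D)) $$ (i, j) =
      (\<Sum>k<b * e. (A $$ (i div d, k div e) * B $$ (i mod d, k mod e)) *
                  (C $$ (k div e, j div f) * D $$ (k mod e, j mod f)))"
    using ij assms by (auto simp: scalar_prod_def kronecker_index lessThan_atLeast0)
  also have "\<dots> = (\<Sum>x<b. \<Sum>y<e. (A $$ (i div d, x) * B $$ (i mod d, y)) *
                  (C $$ (x, j div f) * D $$ (y, j mod f)))"
    by (rule sum_div_mod)
  also have "\<dots> = (\<Sum>x<b. A $$ (i div d, x) * C $$ (x, j div f)) *
                  (\<Sum>y<e. B $$ (i mod d, y) * D $$ (y, j mod f))"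
    by (simp add: sum_product mult_ac)
  also have "\<dots> = ((A * C) \<otimes>\<^sub>K (B * D)) $$ (i, j)"
    using ij ij' assms by (auto simp: scalar_prod_def kronecker_index lessThan_atLeast0)
  finally show "((A \<otimes>\<^sub>K B) * (C \<otimes>\<^sub>K D)) $$ (i, j) = ((A * C) \<otimes>\<^sub>K (B * D)) $$ (i, j)" .
qed (use assms in auto)

lemma kronecker_assoc: "(A \<otimes>\<^sub>K B) \<otimes>\<^sub>K C = A \<otimes>\<^sub>K (B \<otimes>\<^sub>K C)"
proof (rule eq_matI)
  fix i j assume "i < dim_row (A \<otimes>\<^sub>K (B \<otimes>\<^sub>K C))" "j < dim_col (A \<otimes>\<^sub>K (B \<otimes>\<^sub>K C))"
  then have i: "i < (dim_row A * dim_row B) * dim_row C" "i < dim_row A * (dim_row B * dim_row C)"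
    and j: "j < (dim_col A * dim_col B) * dim_col C" "j < dim_col A * (dim_col B * dim_col C)"
    by (auto simp: mult.assoc)
  have split: "x div c div b = x div (b * c)" "x div c mod b = x mod (b * c) div c"
    "x mod c = x mod (b * c) mod c" if "x < a * (b * c)" for x a b c :: nat
    using div_mod_less(3)[OF that]
    by (auto simp: div_mult2_eq mod_mult2_eq mult.commute[of b c])
  show "((A \<otimes>\<^sub>K B) \<otimes>\<^sub>K C) $$ (i, j) = (A \<otimes>\<^sub>K (B \<otimes>\<^sub>K C)) $$ (i, j)"
    using i j split[OF i(2)] split[OF j(2)]
      div_mod_less[OF i(1)] div_mod_less[OF i(2)] div_mod_less[OF j(1)] div_mod_less[OF j(2)]
    by (simp add: kronecker_index)
qed (auto simp: mult.assoc)

lemma kronecker_one: "1\<^sub>m a \<otimes>\<^sub>K 1\<^sub>m b = 1\<^sub>m (a * b)"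
proof (rule eq_matI)
  fix i j assume "i < dim_row (1\<^sub>m (a * b) :: complex mat)" "j < dim_col (1\<^sub>m (a * b) :: complex mat)"
  then have ij: "i < a * b" "j < a * b" by auto
  have "i = j \<longleftrightarrow> i div b = j div b \<and> i mod b = j mod b"
    by (metis div_mult_mod_eq)
  then show "(1\<^sub>m a \<otimes>\<^sub>K 1\<^sub>m b) $$ (i, j) = 1\<^sub>m (a * b) $$ (i, j)"
    using ij div_mod_less[OF ij(1)] div_mod_less[OF ij(2)] by (auto simp: kronecker_index)
qed auto

lemma one_kronecker [simp]: "1\<^sub>m 1 \<otimes>\<^sub>K A = A"
  by (rule eq_matI) (auto simp: kronecker_index)

lemma kronecker_smult_left: "(s \<cdot>\<^sub>m A) \<otimes>\<^sub>K B = s \<cdot>\<^sub>m (A \<otimes>\<^sub>K B)"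
  by (rule eq_matI) (auto simp: kronecker_index div_mod_less)

lemma kronecker_smult_right: "A \<otimes>\<^sub>K (s \<cdot>\<^sub>m B) = s \<cdot>\<^sub>m (A \<otimes>\<^sub>K B)"
  by (rule eq_matI) (auto simp: kronecker_index div_mod_less)

lemma kronecker_minus_left:
  assumes "A \<in> carrier_mat a b" "C \<in> carrier_mat a b"
  shows "(A - C) \<otimes>\<^sub>K B = A \<otimes>\<^sub>K B - C \<otimes>\<^sub>K B"
  using assms by (intro eq_matI) (auto simp: kronecker_index div_mod_less left_diff_distrib)

lemma kronecker_minus_right:
  assumes "A \<in> carrier_mat a b" "C \<in> carrier_mat a b"
  shows "B \<otimes>\<^sub>K (A - C) = B \<otimes>\<^sub>K A - B \<otimes>\<^sub>K C"
  using assms by (intro eq_matI) (auto simp: kronecker_index div_mod_less right_diff_distrib)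

lemma dim_mat_adjoint [simp]: "dim_row (mat_adjoint A) = dim_col A" "dim_col (mat_adjoint A) = dim_row A"
  by (auto simp: mat_adjoint_def)

lemma mat_adjoint_index:
  "i < dim_col A \<Longrightarrow> j < dim_row A \<Longrightarrow> mat_adjoint A $$ (i, j) = cnj (A $$ (j, i))"
  for A :: "complex mat"
  by (simp add: mat_adjoint_def mat_of_rows_index)

lemma mat_adjoint_kronecker: "mat_adjoint (A \<otimes>\<^sub>K B) = mat_adjoint A \<otimes>\<^sub>K mat_adjoint B"
  by (rule eq_matI) (auto simp: kronecker_index mat_adjoint_index div_mod_less)

lemma mat_adjoint_one [simp]: "mat_adjoint (1\<^sub>m a) = (1\<^sub>m a :: complex mat)"
  by (rule eq_matI) (auto simp: mat_adjoint_index)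

lemma mat_adjoint_adjoint [simp]: "mat_adjoint (mat_adjoint A) = (A :: complex mat)"
  by (rule eq_matI) (auto simp: mat_adjoint_index)

lemma ones_col_carrier [simp]: "ones_col a \<in> carrier_mat a 1"
  by (simp add: ones_col_def)

lemma dim_ones_col [simp]: "dim_row (ones_col a) = a" "dim_col (ones_col a) = 1"
  by (simp_all add: ones_col_def)

lemma ones_col_kronecker: "ones_col a \<otimes>\<^sub>K ones_col b = ones_col (a * b)"
  by (rule eq_matI) (auto simp: kronecker_index ones_col_def div_mod_less)

lemma flip_ones_col: "flip (ones_col a) = mat_adjoint (ones_col a)"
  by (rule eq_matI) (auto simp: mat_adjoint_index ones_col_def flip_def)

section \<open>Block matrices and half sums\<close>

lemma block_mat_carrier [simp]: "block_mat nr nc r c F \<in> carrier_mat (nr * r) (nc * c)"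
  by (simp add: block_mat_def)

lemma dim_block_mat [simp]:
  "dim_row (block_mat nr nc r c F) = nr * r" "dim_col (block_mat nr nc r c F) = nc * c"
  by (simp_all add: block_mat_def)

lemma block_mat_index:
  "i < nr * r \<Longrightarrow> j < nc * c \<Longrightarrow>
    block_mat nr nc r c F $$ (i, j) = F (i div r) (j div c) $$ (i mod r, j mod c)"
  by (simp add: block_mat_def)

lemma block_mat_cong:
  assumes "\<And>i k. i < nr \<Longrightarrow> k < nc \<Longrightarrow> F i k = F' i k"
  shows "block_mat nr nc r c F = block_mat nr nc r c F'"
  using assms by (intro eq_matI) (auto simp: block_mat_index div_mod_less)

lemma block_mat_add:
  assumes "\<And>i k. i < nr \<Longrightarrow> k < nc \<Longrightarrow> F' i k \<in> carrier_mat r c"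
  shows "block_mat nr nc r c F + block_mat nr nc r c F' = block_mat nr nc r c (\<lambda>i k. F i k + F' i k)"
  using assms by (intro eq_matI) (auto simp: block_mat_index div_mod_less carrier_matD[OF assms])

lemma flip_block_mat:
  assumes "\<And>i k. i < nr \<Longrightarrow> k < nc \<Longrightarrow> F i k \<in> carrier_mat r c"
  shows "flip (block_mat nr nc r c F) =
    block_mat nc nr c r (\<lambda>i k. flip (F (nr - 1 - k) (nc - 1 - i)))"
proof (rule eq_matI)
  fix i j assume "i < dim_row (block_mat nc nr c r (\<lambda>i k. flip (F (nr - 1 - k) (nc - 1 - i))))"
    "j < dim_col (block_mat nc nr c r (\<lambda>i k. flip (F (nr - 1 - k) (nc - 1 - i))))"
  then have ij: "i < nc * c" "j < nr * r" by auto
  then have "F (nr - 1 - j div r) (nc - 1 - i div c) \<in> carrier_mat r c"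
    using div_mod_less[OF ij(1)] div_mod_less[OF ij(2)] by (intro assms) auto
  then show "flip (block_mat nr nc r c F) $$ (i, j) =
      block_mat nc nr c r (\<lambda>i k. flip (F (nr - 1 - k) (nc - 1 - i))) $$ (i, j)"
    using ij div_mod_less[OF ij(1)] div_mod_less[OF ij(2)]
    by (auto simp: flip_def block_mat_index reverse_index)
qed auto

text \<open>Every product with \<open>M_31\<close> or \<open>M_32\<close> has this form: the factor \<open>A\<close> mixes the blocks and the factor
\<open>B\<close> acts inside each block.\<close>

lemma block_mat_mult_kronecker_index:
  assumes "\<And>i k. i < nr \<Longrightarrow> k < nc \<Longrightarrow> F i k \<in> carrier_mat r c"
    and "A \<in> carrier_mat nc a" "B \<in> carrier_mat c b" and ij: "i < nr * r" "j < a * b"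
  shows "(block_mat nr nc r c F * (A \<otimes>\<^sub>K B)) $$ (i, j) =
    (\<Sum>x<nc. A $$ (x, j div b) * (F (i div r) x * B) $$ (i mod r, j mod b))"
proof -
  note ij' = div_mod_less[OF ij(1)] div_mod_less[OF ij(2)]
  have "(block_mat nr nc r c F * (A \<otimes>\<^sub>K B)) $$ (i, j) =
      (\<Sum>k<nc * c. F (i div r) (k div c) $$ (i mod r, k mod c) *
         (A $$ (k div c, j div b) * B $$ (k mod c, j mod b)))"
    using assms by (auto simp: scalar_prod_def kronecker_index block_mat_index lessThan_atLeast0)
  also have "\<dots> = (\<Sum>x<nc. \<Sum>y<c. F (i div r) x $$ (i mod r, y) *
         (A $$ (x, j div b) * B $$ (y, j mod b)))"
    by (rule sum_div_mod)
  also have "\<dots> = (\<Sum>x<nc. A $$ (x, j div b) * (\<Sum>y<c. F (i div r) x $$ (i mod r, y) * B $$ (y, j mod b)))"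
    by (simp add: sum_distrib_left mult_ac)
  also have "\<dots> = (\<Sum>x<nc. A $$ (x, j div b) * (F (i div r) x * B) $$ (i mod r, j mod b))"
  proof (rule sum.cong)
    fix x assume "x \<in> {..<nc}"
    then have "F (i div r) x \<in> carrier_mat r c" using assms ij' by auto
    then show "A $$ (x, j div b) * (\<Sum>y<c. F (i div r) x $$ (i mod r, y) * B $$ (y, j mod b)) =
        A $$ (x, j div b) * (F (i div r) x * B) $$ (i mod r, j mod b)"
      using ij' assms by (auto simp: scalar_prod_def lessThan_atLeast0)
  qed auto
  finally show ?thesis .
qed

lemma block_mat_mult_one_kronecker:
  assumes F: "\<And>i k. i < nr \<Longrightarrow> k < nc \<Longrightarrow> F i k \<in> carrier_mat r c"
    and B: "B \<in> carrier_mat c b"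
  shows "block_mat nr nc r c F * (1\<^sub>m nc \<otimes>\<^sub>K B) = block_mat nr nc r b (\<lambda>i k. F i k * B)"
proof (rule eq_matI)
  fix i j assume "i < dim_row (block_mat nr nc r b (\<lambda>i k. F i k * B))"
    "j < dim_col (block_mat nr nc r b (\<lambda>i k. F i k * B))"
  then have ij: "i < nr * r" "j < nc * b" by auto
  note ij' = div_mod_less[OF ij(1)] div_mod_less[OF ij(2)]
  have "(block_mat nr nc r c F * (1\<^sub>m nc \<otimes>\<^sub>K B)) $$ (i, j) =
      (\<Sum>x<nc. 1\<^sub>m nc $$ (x, j div b) * (F (i div r) x * B) $$ (i mod r, j mod b))"
    using assms ij by (intro block_mat_mult_kronecker_index) auto
  also have "\<dots> = (\<Sum>x<nc. if x = j div b then (F (i div r) x * B) $$ (i mod r, j mod b) else 0)"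
    using ij' by (intro sum.cong) auto
  also have "\<dots> = block_mat nr nc r b (\<lambda>i k. F i k * B) $$ (i, j)"
    using ij ij' by (simp add: block_mat_index)
  finally show "(block_mat nr nc r c F * (1\<^sub>m nc \<otimes>\<^sub>K B)) $$ (i, j) =
      block_mat nr nc r b (\<lambda>i k. F i k * B) $$ (i, j)" .
qed (use assms in auto)

lemma half_sum_carrier [simp]:
  assumes "\<And>s. X s \<in> carrier_mat r c"
  shows "half_sum X i \<in> carrier_mat r c"
  by (induction i) (simp_all add: assms)

lemma half_sum_add:
  assumes "\<And>s. X s \<in> carrier_mat r c" "\<And>s. Y s \<in> carrier_mat r c"
  shows "half_sum (\<lambda>s. X s + Y s) i = half_sum X i + half_sum Y i"
proof (induction i)
  case 0
  then show ?case using assms by (simp add: add_smult_distrib_left_mat[of _ r c])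
next
  case (Suc i)
  have "half_sum X i \<in> carrier_mat r c" "half_sum Y i \<in> carrier_mat r c"
    "X (Suc i) \<in> carrier_mat r c" "Y (Suc i) \<in> carrier_mat r c" using assms by auto
  then show ?case using Suc by (intro eq_matI) auto
qed

lemma half_sum_mult:
  assumes "\<And>s. X s \<in> carrier_mat r c" "B \<in> carrier_mat c b"
  shows "half_sum (\<lambda>s. X s * B) i = half_sum X i * B"
proof (induction i)
  case (Suc i)
  have "half_sum X i \<in> carrier_mat r c" "X (Suc i) \<in> carrier_mat r c" using assms by auto
  then show ?case using Suc assms by (simp add: add_mult_distrib_mat[of _ r c])
qed (use assms in \<open>auto simp: mult_smult_assoc_mat[of _ r c]\<close>)

lemma half_sum_flip:
  assumes "\<And>s. X s \<in> carrier_mat r c"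
  shows "half_sum (\<lambda>s. flip (X s)) i = flip (half_sum X i)"
proof (induction i)
  case (Suc i)
  have "half_sum X i \<in> carrier_mat r c" "X (Suc i) \<in> carrier_mat r c" using assms by auto
  then show ?case using Suc by (simp add: flip_add)
qed (auto simp: flip_smult)

lemma half_sum_index:
  assumes "\<And>s. X s \<in> carrier_mat r c" "a < r" "b < c"
  shows "half_sum X i $$ (a, b) = X 0 $$ (a, b) / 2 + (\<Sum>s<i. X (Suc s) $$ (a, b))"
proof (induction i)
  case 0
  then show ?case using assms(2,3) carrier_matD[OF assms(1)] by simp
next
  case (Suc i)
  then show ?case
    using assms(2,3) carrier_matD[OF assms(1)] half_sum_carrier[of X r c i, OF assms(1)] by simp
qed

text \<open>Split the row at the diagonal \<open>k = i\<close> and give half of the diagonal entry to either side.\<close>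

lemma sum_toeplitz_row:
  fixes f :: "int \<Rightarrow> complex"
  assumes "i < n"
  shows "(\<Sum>k<n. f (int i - int k)) =
    (f 0 / 2 + (\<Sum>s<i. f (int (Suc s)))) + (f 0 / 2 + (\<Sum>s<n - 1 - i. f (- int (Suc s))))"
proof -
  have "(\<Sum>k<n. f (int i - int k)) =
      (\<Sum>k<i. f (int i - int k)) + f 0 + (\<Sum>k\<in>{Suc i..<n}. f (int i - int k))"
    using assms sum.atLeastLessThan_concat[of 0 i n "\<lambda>k. f (int i - int k)"]
      sum.atLeast_Suc_lessThan[of i n "\<lambda>k. f (int i - int k)"]
    by (simp add: lessThan_atLeast0 add.assoc)
  also have "(\<Sum>k<i. f (int i - int k)) = (\<Sum>s<i. f (int (Suc s)))"
    by (rule sum.reindex_bij_witness[of _ "\<lambda>s. i - 1 - s" "\<lambda>k. i - 1 - k"])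
      (auto simp: of_nat_diff)
  also have "(\<Sum>k\<in>{Suc i..<n}. f (int i - int k)) = (\<Sum>s<n - 1 - i. f (- int (Suc s)))"
    by (rule sum.reindex_bij_witness[of _ "\<lambda>s. s + Suc i" "\<lambda>k. k - Suc i"])
      (auto simp: of_nat_diff)
  finally show ?thesis by simp
qed

lemma block_toeplitz_carrier [simp]: "block_toeplitz n r c X \<in> carrier_mat (n * r) (n * c)"
  by (simp add: block_toeplitz_def)

lemma block_col_carrier [simp]: "block_col n r c X \<in> carrier_mat (n * r) c"
  using block_mat_carrier[of n 1 r c] by (simp add: block_col_def)

lemma block_row_carrier [simp]: "block_row n r c X \<in> carrier_mat r (n * c)"
  using block_mat_carrier[of 1 n r c] by (simp add: block_row_def)

lemma flip_block_toeplitz: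
  assumes "\<And>d. X d \<in> carrier_mat r c"
  shows "flip (block_toeplitz n r c X) = block_toeplitz n c r (\<lambda>d. flip (X d))"
  unfolding block_toeplitz_def
  by (subst flip_block_mat) (auto simp: assms of_nat_diff intro!: block_mat_cong)

lemma flip_block_row:
  assumes "\<And>s. X s \<in> carrier_mat r c"
  shows "flip (block_row n r c X) = block_col n c r (\<lambda>i. flip (X (n - 1 - i)))"
  unfolding block_row_def block_col_def
  by (subst flip_block_mat) (auto simp: assms intro!: block_mat_cong)

lemma block_toeplitz_add:
  assumes "\<And>d. Y d \<in> carrier_mat r c"
  shows "block_toeplitz n r c X + block_toeplitz n r c Y = block_toeplitz n r c (\<lambda>d. X d + Y d)"
  unfolding block_toeplitz_def by (subst block_mat_add) (auto simp: assms)

lemma block_row_add: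
  assumes "\<And>d. Y d \<in> carrier_mat r c"
  shows "block_row n r c X + block_row n r c Y = block_row n r c (\<lambda>d. X d + Y d)"
  unfolding block_row_def by (subst block_mat_add) (auto simp: assms)

lemma block_toeplitz_mult_one_kronecker:
  assumes "\<And>d. X d \<in> carrier_mat r c" "B \<in> carrier_mat c b"
  shows "block_toeplitz n r c X * (1\<^sub>m n \<otimes>\<^sub>K B) = block_toeplitz n r b (\<lambda>d. X d * B)"
  unfolding block_toeplitz_def using assms by (intro block_mat_mult_one_kronecker) auto

lemma block_row_mult_one_kronecker:
  assumes "\<And>d. X d \<in> carrier_mat r c" "B \<in> carrier_mat c b"
  shows "block_row n r c X * (1\<^sub>m n \<otimes>\<^sub>K B) = block_row n r b (\<lambda>d. X d * B)"
  unfolding block_row_def using assms by (intro block_mat_mult_one_kronecker) auto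

text \<open>The row sums of a block Toeplitz matrix. The half sums over nonpositive differences come in the
reverse order, because row \<open>i\<close> has \<open>n - 1 - i\<close> blocks to the right of the diagonal; a reflection of a
block row produces this order, at the price of reflecting each block once more.\<close>

lemma block_toeplitz_mult_ones:
  assumes X: "\<And>d. X d \<in> carrier_mat r c"
  shows "block_toeplitz n r c X * (ones_col n \<otimes>\<^sub>K 1\<^sub>m c) =
    block_col n r c (half_sum (\<lambda>s. X (int s))) +
    flip (block_row n c r (half_sum (\<lambda>s. flip (X (- int s)))))"
    (is "?l = ?a + flip ?b")
proof (rule eq_matI)
  have b: "flip ?b = block_col n r c (\<lambda>i. half_sum (\<lambda>s. X (- int s)) (n - 1 - i))"
    by (subst flip_block_row) (auto simp: X half_sum_flip[of "\<lambda>s. X (- int s)" r c])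
  fix i j assume "i < dim_row (?a + flip ?b)" "j < dim_col (?a + flip ?b)"
  then have ij: "i < n * r" "j < c" by (auto simp: block_row_def)
  note i' = div_mod_less[OF ij(1)]
  have "?l $$ (i, j) = (\<Sum>x<n. ones_col n $$ (x, j div c) *
      (X (int (i div r) - int x) * 1\<^sub>m c) $$ (i mod r, j mod c))"
    unfolding block_toeplitz_def using ij X by (intro block_mat_mult_kronecker_index[of _ _ _ _ _ _ 1]) auto
  also have "\<dots> = (\<Sum>x<n. X (int (i div r) - int x) $$ (i mod r, j))"
    using ij by (intro sum.cong) (auto simp: ones_col_def right_mult_one_mat[OF X])
  also have "\<dots> = half_sum (\<lambda>s. X (int s)) (i div r) $$ (i mod r, j) +
      half_sum (\<lambda>s. X (- int s)) (n - 1 - i div r) $$ (i mod r, j)"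
    using i' ij X by (subst sum_toeplitz_row) (auto simp: half_sum_index[of _ r c])
  also have "\<dots> = (?a + flip ?b) $$ (i, j)"
    unfolding b block_col_def using ij by (simp add: block_mat_index)
  finally show "?l $$ (i, j) = (?a + flip ?b) $$ (i, j)" .
qed (auto simp: block_toeplitz_def block_row_def)

section \<open>Rows and columns of matrices\<close>

lemma append_cols_carrier [simp]:
  "A \<in> carrier_mat r c \<Longrightarrow> B \<in> carrier_mat r d \<Longrightarrow> A @\<^sub>c B \<in> carrier_mat r (c + d)"
  by (auto simp: append_cols_def)

lemma append_cols_index:
  "A \<in> carrier_mat r c \<Longrightarrow> B \<in> carrier_mat r d \<Longrightarrow> i < r \<Longrightarrow> j < c + d \<Longrightarrow>
    (A @\<^sub>c B) $$ (i, j) = (if j < c then A $$ (i, j) else B $$ (i, j - c))"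
  by (auto simp: append_cols_def)

lemma append_rows_index:
  "A \<in> carrier_mat r c \<Longrightarrow> B \<in> carrier_mat s c \<Longrightarrow> i < r + s \<Longrightarrow> j < c \<Longrightarrow>
    (A @\<^sub>r B) $$ (i, j) = (if i < r then A $$ (i, j) else B $$ (i - r, j))"
  by (auto simp: append_rows_def)

lemma col_append_cols:
  assumes "A \<in> carrier_mat r c" "B \<in> carrier_mat r d" "j < c + d"
  shows "col (A @\<^sub>c B) j = (if j < c then col A j else col B (j - c))"
proof -
  have "dim_row (A @\<^sub>c B) = r" "dim_col (A @\<^sub>c B) = c + d"
    using append_cols_carrier[OF assms(1,2)] by auto
  then show ?thesis
    using assms by (intro eq_vecI) (auto simp: append_cols_index[OF assms(1,2)])
qed

lemma row_append_rows:
  assumes "A \<in> carrier_mat r c" "B \<in> carrier_mat s c" "i < r + s"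
  shows "row (A @\<^sub>r B) i = (if i < r then row A i else row B (i - r))"
proof -
  have "dim_row (A @\<^sub>r B) = r + s" "dim_col (A @\<^sub>r B) = c"
    using carrier_append_rows[OF assms(1,2)] by auto
  then show ?thesis
    using assms by (intro eq_vecI) (auto simp: append_rows_index[OF assms(1,2)])
qed

lemma mult_append_cols:
  assumes "C \<in> carrier_mat a r" "A \<in> carrier_mat r c" "B \<in> carrier_mat r d"
  shows "C * (A @\<^sub>c B) = (C * A) @\<^sub>c (C * B)"
proof -
  have CA: "C * A \<in> carrier_mat a c" "C * B \<in> carrier_mat a d" using assms by auto
  have dims: "dim_col (A @\<^sub>c B) = c + d" "dim_row ((C * A) @\<^sub>c (C * B)) = a"
    "dim_col ((C * A) @\<^sub>c (C * B)) = c + d"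
    using append_cols_carrier[OF assms(2,3)] append_cols_carrier[OF CA] by auto
  show ?thesis
    by (rule eq_matI)
      (use assms in \<open>auto simp: dims append_cols_index[OF CA] col_append_cols[OF assms(2,3)]\<close>)
qed

lemma append_rows_mult:
  assumes "C \<in> carrier_mat c a" "A \<in> carrier_mat r c" "B \<in> carrier_mat s c"
  shows "(A @\<^sub>r B) * C = (A * C) @\<^sub>r (B * C)"
proof -
  have CA: "A * C \<in> carrier_mat r a" "B * C \<in> carrier_mat s a" using assms by auto
  have dims: "dim_row (A @\<^sub>r B) = r + s" "dim_row ((A * C) @\<^sub>r (B * C)) = r + s"
    "dim_col ((A * C) @\<^sub>r (B * C)) = a"
    using carrier_append_rows[OF assms(2,3)] carrier_append_rows[OF CA] by auto
  show ?thesis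
    by (rule eq_matI)
      (use assms in \<open>auto simp: dims append_rows_index[OF CA] row_append_rows[OF assms(2,3)]\<close>)
qed

lemma append_rows_mult_append_cols:
  assumes "A \<in> carrier_mat r n" "B \<in> carrier_mat s n" "C \<in> carrier_mat n c" "D \<in> carrier_mat n d"
  shows "(A @\<^sub>r B) * (C @\<^sub>c D) = four_block_mat (A * C) (A * D) (B * C) (B * D)"
proof -
  have dims: "dim_row (A @\<^sub>r B) = r + s" "dim_col (C @\<^sub>c D) = c + d"
    using carrier_append_rows[OF assms(1,2)] append_cols_carrier[OF assms(3,4)] by auto
  show ?thesis
    by (rule eq_matI)
      (use assms in \<open>auto simp: dims row_append_rows[OF assms(1,2)] col_append_cols[OF assms(3,4)]\<close>)
qed

lemma transpose_append_rows:
  assumes "A \<in> carrier_mat r c" "B \<in> carrier_mat s c"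
  shows "transpose_mat (A @\<^sub>r B) = transpose_mat A @\<^sub>c transpose_mat B"
proof -
  have T: "transpose_mat A \<in> carrier_mat c r" "transpose_mat B \<in> carrier_mat c s" using assms by auto
  have dims: "dim_row (A @\<^sub>r B) = r + s" "dim_col (A @\<^sub>r B) = c"
    "dim_row (transpose_mat A @\<^sub>c transpose_mat B) = c"
    "dim_col (transpose_mat A @\<^sub>c transpose_mat B) = r + s"
    using carrier_append_rows[OF assms] append_cols_carrier[OF T] by auto
  show ?thesis
    by (rule eq_matI)
      (use assms in \<open>auto simp: dims append_rows_index[OF assms] append_cols_index[OF T]\<close>)
qed

lemma append_cols_mult_four_block:
  assumes "A \<in> carrier_mat a c" "B \<in> carrier_mat a d"
    and "P \<in> carrier_mat c e" "Q \<in> carrier_mat c f" "R \<in> carrier_mat d e" "S \<in> carrier_mat d f"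
  shows "(A @\<^sub>c B) * four_block_mat P Q R S = (A * P + B * R) @\<^sub>c (A * Q + B * S)"
  unfolding append_cols_def
  using assms by (subst mult_four_block_mat[of _ a c _ d _ 0 _ _ e _ f]) auto

section \<open>The exchange matrices\<close>

definition exchange :: "nat \<Rightarrow> complex mat" where
  "exchange n = mat n n (\<lambda>(i, k). if i + k + 1 = n then 1 else 0)"

lemma exchange_carrier [simp]: "exchange n \<in> carrier_mat n n"
  by (simp add: exchange_def)

lemma dim_exchange [simp]: "dim_row (exchange n) = n" "dim_col (exchange n) = n"
  by (simp_all add: exchange_def)

lemma U_eq_exchange: "U m p = exchange (m p)"
  by (simp add: U_def exchange_def)

lemma exchange_mult:
  assumes "A \<in> carrier_mat a b"
  shows "exchange a * A = mat a b (\<lambda>(i, j). A $$ (a - 1 - i, j))"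
proof (rule eq_matI)
  fix i j assume "i < dim_row (mat a b (\<lambda>(i, j). A $$ (a - 1 - i, j)))"
    "j < dim_col (mat a b (\<lambda>(i, j). A $$ (a - 1 - i, j)))"
  then have ij: "i < a" "j < b" by auto
  have "(exchange a * A) $$ (i, j) = (\<Sum>k<a. exchange a $$ (i, k) * A $$ (k, j))"
    using ij assms by (simp add: scalar_prod_def lessThan_atLeast0)
  also have "\<dots> = (\<Sum>k<a. if k = a - 1 - i then A $$ (k, j) else 0)"
    using ij by (intro sum.cong) (auto simp: exchange_def)
  finally show "(exchange a * A) $$ (i, j) = mat a b (\<lambda>(i, j). A $$ (a - 1 - i, j)) $$ (i, j)"
    using ij by simp
qed (use assms in auto)

lemma mult_exchange:
  assumes "A \<in> carrier_mat a b"
  shows "A * exchange b = mat a b (\<lambda>(i, j). A $$ (i, b - 1 - j))"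
proof (rule eq_matI)
  fix i j assume "i < dim_row (mat a b (\<lambda>(i, j). A $$ (i, b - 1 - j)))"
    "j < dim_col (mat a b (\<lambda>(i, j). A $$ (i, b - 1 - j)))"
  then have ij: "i < a" "j < b" by auto
  have "(A * exchange b) $$ (i, j) = (\<Sum>k<b. A $$ (i, k) * exchange b $$ (k, j))"
    using ij assms by (simp add: scalar_prod_def lessThan_atLeast0)
  also have "\<dots> = (\<Sum>k<b. if k = b - 1 - j then A $$ (i, k) else 0)"
    using ij by (intro sum.cong) (auto simp: exchange_def)
  finally show "(A * exchange b) $$ (i, j) = mat a b (\<lambda>(i, j). A $$ (i, b - 1 - j)) $$ (i, j)"
    using ij by simp
qed (use assms in auto)

lemma flip_eq_exchange:
  assumes "A \<in> carrier_mat a b"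
  shows "exchange b * transpose_mat A * exchange a = flip A"
proof -
  have T: "transpose_mat A \<in> carrier_mat b a" using assms by simp
  show ?thesis
    unfolding exchange_mult[OF T] mult_exchange[OF mat_carrier]
    using assms by (intro eq_matI) (auto simp: flip_def)
qed

lemma exchange_kronecker: "exchange a \<otimes>\<^sub>K exchange b = exchange (a * b)"
proof (rule eq_matI)
  fix i j assume "i < dim_row (exchange (a * b))" "j < dim_col (exchange (a * b))"
  then have ij: "i < a * b" "j < a * b" by auto
  note ij' = div_mod_less[OF ij(1)] div_mod_less[OF ij(2)]
  have *: "x + y + 1 = n \<longleftrightarrow> x = n - Suc y" if "y < n" for x y n :: nat
    using that by auto
  have "i + j + 1 = a * b \<longleftrightarrow> i div b + j div b + 1 = a \<and> i mod b + j mod b + 1 = b"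
    unfolding *[OF ij(2)] *[OF ij'(4)] *[OF ij'(5)] reverse_index[OF ij(2), symmetric]
    by (metis div_mult_mod_eq)
  then show "(exchange a \<otimes>\<^sub>K exchange b) $$ (i, j) = exchange (a * b) $$ (i, j)"
    using ij ij' by (auto simp: kronecker_index exchange_def)
qed auto

lemma Utilde_eq_exchange: "Utilde m k = four_block_mat
    (0\<^sub>m (m k * m 3) (m k * m 3)) (- exchange (m k * m 3))
    (exchange (m k * m 3)) (0\<^sub>m (m k * m 3) (m k * m 3))"
  by (simp add: Utilde_def U_eq_exchange exchange_kronecker)

text \<open>The effect of \<open>Utilde\<close> in the reflection formula for \<open>u_p\<close>.\<close>

lemma exchange_transpose_Utilde:
  assumes "P \<in> carrier_mat (m k * m 3) c" "Q \<in> carrier_mat (m k * m 3) c"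
  shows "exchange c * transpose_mat (P @\<^sub>r Q) * Utilde m k = flip Q @\<^sub>c (- flip P)"
proof -
  define N where "N = m k * m 3"
  have P: "P \<in> carrier_mat N c" "transpose_mat P \<in> carrier_mat c N"
    "exchange c * transpose_mat P \<in> carrier_mat c N"
    and Q: "Q \<in> carrier_mat N c" "transpose_mat Q \<in> carrier_mat c N"
    "exchange c * transpose_mat Q \<in> carrier_mat c N"
    using assms by (auto simp: N_def)
  have m: "exchange c * transpose_mat P * (- exchange N) = - flip P"
    using P flip_eq_exchange[OF P(1)] by simp
  have z: "exchange c * transpose_mat P * 0\<^sub>m N N = 0\<^sub>m c N"
    "exchange c * transpose_mat Q * 0\<^sub>m N N = 0\<^sub>m c N"
    using right_mult_zero_mat[OF P(3)] right_mult_zero_mat[OF Q(3)] by auto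
  show ?thesis
    unfolding transpose_append_rows[OF assms] Utilde_eq_exchange N_def[symmetric]
    using P Q flip_eq_exchange[OF Q(1)] m z
    by (simp add: mult_append_cols[OF exchange_carrier P(2) Q(2)]
      append_cols_mult_four_block[of _ c N _ N _ N _ N])
qed

text \<open>The effect of the two matrices \<open>Utilde\<close> in the formula for \<open>G_21\<close>.\<close>

lemma Utilde_transpose_Utilde:
  assumes "a \<in> carrier_mat (m 2 * m 3) (m 1 * m 3)" "b \<in> carrier_mat (m 2 * m 3) (m 1 * m 3)"
    "c \<in> carrier_mat (m 2 * m 3) (m 1 * m 3)" "d \<in> carrier_mat (m 2 * m 3) (m 1 * m 3)"
  shows "Utilde m 1 * transpose_mat (four_block_mat a b c d) * Utilde m 2 =
    four_block_mat (- flip d) (flip b) (flip c) (- flip a)"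
proof -
  define N1 where "N1 = m 1 * m 3"
  define N2 where "N2 = m 2 * m 3"
  define J1 where "J1 = exchange N1"
  define J2 where "J2 = exchange N2"
  define a' where "a' = transpose_mat a"
  define b' where "b' = transpose_mat b"
  define c' where "c' = transpose_mat c"
  define d' where "d' = transpose_mat d"
  have J: "J1 \<in> carrier_mat N1 N1" "J2 \<in> carrier_mat N2 N2" by (simp_all add: J1_def J2_def)
  have abcd: "a \<in> carrier_mat N2 N1" "b \<in> carrier_mat N2 N1" "c \<in> carrier_mat N2 N1"
    "d \<in> carrier_mat N2 N1" using assms by (simp_all add: N1_def N2_def)
  then have t: "a' \<in> carrier_mat N1 N2" "b' \<in> carrier_mat N1 N2" "c' \<in> carrier_mat N1 N2"
    "d' \<in> carrier_mat N1 N2" by (simp_all add: a'_def b'_def c'_def d'_def)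
  note f = abcd[THEN flip_eq_exchange, folded J1_def J2_def a'_def b'_def c'_def d'_def]
  have Jt: "J1 * a' \<in> carrier_mat N1 N2" "J1 * b' \<in> carrier_mat N1 N2"
    "J1 * c' \<in> carrier_mat N1 N2" "J1 * d' \<in> carrier_mat N1 N2" using J t by auto
  have "Utilde m 1 * transpose_mat (four_block_mat a b c d) =
      four_block_mat (- (J1 * b')) (- (J1 * d')) (J1 * a') (J1 * c')"
    unfolding Utilde_eq_exchange N1_def[symmetric] J1_def[symmetric]
      transpose_four_block_mat[OF abcd, folded a'_def b'_def c'_def d'_def]
    using J t Jt
    by (subst mult_four_block_mat[of _ N1 N1 _ N1 _ N1 _ _ N2 _ N2]) auto
  also have "\<dots> * Utilde m 2 = four_block_mat (- (J1 * d' * J2)) (J1 * b' * J2) (J1 * c' * J2) (- (J1 * a' * J2))"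
    unfolding Utilde_eq_exchange N2_def[symmetric] J2_def[symmetric]
    using J t Jt
    by (subst mult_four_block_mat[of _ N1 N2 _ N2 _ N1 _ _ N2 _ N2])
      auto
  finally show ?thesis by (simp add: f)
qed

section \<open>Symmetries of the Toeplitz data\<close>

\<comment> \<open>The simplifier would otherwise turn \<open>m 1\<close> into \<open>m (Suc 0)\<close>.\<close>
declare One_nat_def [simp del]

lemma toep_inner_carrier [simp]: "toep_inner m \<tau> r s \<in> carrier_mat (m 3) (m 3)"
  by (simp add: toep_inner_def)

lemma toep_middle_carrier [simp]: "toep_middle m \<tau> r \<in> carrier_mat (m 2 * m 3) (m 2 * m 3)"
  by (simp add: toep_middle_def)

lemma toeplitz3_carrier [simp]:
  "toeplitz3 m \<tau> \<in> carrier_mat (m 1 * (m 2 * m 3)) (m 1 * (m 2 * m 3))"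
  by (simp add: toeplitz3_def)

lemma flip_toep_inner: "flip (toep_inner m \<tau> r s) = toep_inner m \<tau> r s"
  by (rule eq_matI) (auto simp: flip_def toep_inner_def of_nat_diff)

lemma flip_toep_middle: "flip (toep_middle m \<tau> r) = toep_middle m \<tau> r"
  unfolding toep_middle_def by (subst flip_block_toeplitz) (auto simp: flip_toep_inner)

lemma flip_toeplitz3: "flip (toeplitz3 m \<tau>) = toeplitz3 m \<tau>"
  unfolding toeplitz3_def by (subst flip_block_toeplitz) (auto simp: flip_toep_middle)

lemma mat_adjoint_ones_carrier [simp]: "mat_adjoint (ones_col a) \<in> carrier_mat 1 a"
  by auto

lemma M31_eq: "M31 m = ones_col (m 1) \<otimes>\<^sub>K 1\<^sub>m (m 2 * m 3)"
  by (simp add: M31_def M21_def mat_adjoint_kronecker)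

lemma M32_eq: "M32 m = 1\<^sub>m (m 1) \<otimes>\<^sub>K (ones_col (m 2) \<otimes>\<^sub>K 1\<^sub>m (m 3))"
  by (simp add: M32_def M22_def mat_adjoint_kronecker)

lemma M31_carrier [simp]: "M31 m \<in> carrier_mat (m 1 * (m 2 * m 3)) (m 2 * m 3)"
  by (rule carrier_matI) (simp_all add: M31_eq)

lemma M32_carrier [simp]: "M32 m \<in> carrier_mat (m 1 * (m 2 * m 3)) (m 1 * m 3)"
  by (rule carrier_matI) (simp_all add: M32_eq)

lemma M21_eq: "M21 m = flip (M31 m)"
  by (simp add: M31_eq M21_def flip_kronecker flip_ones_col)

lemma M22_eq: "M22 m = flip (M32 m)"
  by (simp add: M32_eq M22_def flip_kronecker flip_ones_col)

lemma M21_carrier [simp]: "M21 m \<in> carrier_mat (m 2 * m 3) (m 1 * (m 2 * m 3))"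
  by (simp add: M21_eq)

lemma M22_carrier [simp]: "M22 m \<in> carrier_mat (m 1 * m 3) (m 1 * (m 2 * m 3))"
  by (simp add: M22_eq)

lemma M11_carrier [simp]: "M11 m \<tau> \<in> carrier_mat (m 1 * (m 2 * m 3)) (m 2 * m 3)"
  by (simp add: M11_def)

lemma M41_carrier [simp]: "M41 m \<tau> \<in> carrier_mat (m 2 * m 3) (m 1 * (m 2 * m 3))"
  by (simp add: M41_def)

lemma M12_block_carrier [simp]: "M12_block m \<tau> r \<in> carrier_mat (m 2 * m 3) (m 3)"
  by (simp add: M12_block_def)

lemma M42_block_carrier [simp]: "M42_block m \<tau> r \<in> carrier_mat (m 3) (m 2 * m 3)"
  by (simp add: M42_block_def)

lemma M12_carrier [simp]: "M12 m \<tau> \<in> carrier_mat (m 1 * (m 2 * m 3)) (m 1 * m 3)"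
  by (simp add: M12_def)

lemma M42_carrier [simp]: "M42 m \<tau> \<in> carrier_mat (m 1 * m 3) (m 1 * (m 2 * m 3))"
  by (simp add: M42_def)

lemma K11_carrier [simp]: "K11 m \<tau> \<in> carrier_mat (m 1 * m 3) (m 2 * m 3)"
  by (simp add: K11_def)

lemma K12_carrier [simp]: "K12 m \<tau> \<in> carrier_mat (m 2 * m 3) (m 1 * m 3)"
  by (simp add: K12_def)

text \<open>Row sums in the outermost direction.\<close>

lemma toeplitz3_mult_M31: "toeplitz3 m \<tau> * M31 m = M11 m \<tau> + flip (M41 m \<tau>)"
  unfolding toeplitz3_def M31_eq M11_def M41_def
  by (subst block_toeplitz_mult_ones) (simp_all add: flip_toep_middle)

lemma toep_middle_mult_ones:
  "toep_middle m \<tau> r * (ones_col (m 2) \<otimes>\<^sub>K 1\<^sub>m (m 3)) =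
    M12_block m \<tau> r + flip (M42_block m \<tau> r)"
  unfolding toep_middle_def M12_block_def M42_block_def
  by (subst block_toeplitz_mult_ones) (simp_all add: flip_toep_inner)

lemma ones_kronecker_one_carrier [simp]: "ones_col a \<otimes>\<^sub>K 1\<^sub>m b \<in> carrier_mat (a * b) b"
  by (rule carrier_matI) simp_all

text \<open>Row sums in the middle direction, taken inside each block of the outer Toeplitz structure.\<close>

lemma toeplitz3_mult_M32: "toeplitz3 m \<tau> * M32 m = M12 m \<tau> + flip (M42 m \<tau>)"
proof -
  have "toeplitz3 m \<tau> * M32 m =
      block_toeplitz (m 1) (m 2 * m 3) (m 3) (\<lambda>r. M12_block m \<tau> r + flip (M42_block m \<tau> r))"
    unfolding toeplitz3_def M32_eq
    by (subst block_toeplitz_mult_one_kronecker) (simp_all add: toep_middle_mult_ones)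
  also have "\<dots> = M12 m \<tau> + flip (M42 m \<tau>)"
    unfolding M12_def M42_def
    by (subst flip_block_toeplitz[of _ "m 3" "m 2 * m 3"]) (simp_all add: block_toeplitz_add)
  finally show ?thesis .
qed

text \<open>Both products sum in one outer direction a quantity that is already a half sum in the other one.
In \<open>M_42 M_31\<close> the half sum in the middle direction runs over nonpositive differences, and the full
sum in the outer direction splits into \<open>K_11\<close> and a part with nonpositive differences in both
directions. The same doubly nonpositive part, reflected, is left over when the full sum in the middle
direction that forms \<open>M_41 M_32\<close> is split.\<close>

lemma K11_decomposition:
  "\<exists>E\<in>carrier_mat (m 2 * m 3) (m 1 * m 3).
    M42 m \<tau> * M31 m = K11 m \<tau> + flip E \<and> M41 m \<tau> * M32 m = K12 m \<tau> + E"
proof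
  \<comment> \<open>The half sum in both directions over nonpositive differences.\<close>
  let ?F = "\<lambda>s. flip (M42_block m \<tau> (- int s))"
  let ?E = "block_row (m 1) (m 2 * m 3) (m 3) (half_sum ?F)"
  show "?E \<in> carrier_mat (m 2 * m 3) (m 1 * m 3)" by simp
  have "M41 m \<tau> * M32 m = block_row (m 1) (m 2 * m 3) (m 3)
      (\<lambda>i. half_sum (\<lambda>s. toep_middle m \<tau> (- int s)) i * (ones_col (m 2) \<otimes>\<^sub>K 1\<^sub>m (m 3)))"
    unfolding M41_def M32_eq by (rule block_row_mult_one_kronecker) simp_all
  also have "\<dots> = block_row (m 1) (m 2 * m 3) (m 3)
      (half_sum (\<lambda>s. M12_block m \<tau> (- int s) + ?F s))"
    by (subst half_sum_mult[of _ "m 2 * m 3" "m 2 * m 3", symmetric]) (auto simp: toep_middle_mult_ones)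
  also have "\<dots> = K12 m \<tau> + ?E"
  proof -
    have "half_sum (\<lambda>s. M12_block m \<tau> (- int s) + ?F s) =
        (\<lambda>i. half_sum (\<lambda>s. M12_block m \<tau> (- int s)) i + half_sum ?F i)"
      by (rule ext, rule half_sum_add[of _ "m 2 * m 3" "m 3"]) simp_all
    then show ?thesis unfolding K12_def by (subst block_row_add) simp_all
  qed
  finally have "M41 m \<tau> * M32 m = K12 m \<tau> + ?E" .
  moreover have "M42 m \<tau> * M31 m = K11 m \<tau> + flip ?E"
    unfolding M42_def M31_eq K11_def by (subst block_toeplitz_mult_ones) simp_all
  ultimately show "M42 m \<tau> * M31 m = K11 m \<tau> + flip ?E \<and> M41 m \<tau> * M32 m = K12 m \<tau> + ?E"
    by blast
qed

section \<open>Inverses\<close>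

lemma mat_inv_eqI:
  assumes "A \<in> carrier_mat n n" "B \<in> carrier_mat n n" "A * B = 1\<^sub>m n"
  shows "mat_inv A = B"
proof -
  have "B * A = 1\<^sub>m n" using mat_mult_left_right_inverse[OF assms] .
  then have "invertible_mat A"
    using assms by (auto simp: invertible_mat_def inverts_mat_def)
  note I = mat_inv_invertible[OF this assms(1)]
  have "mat_inv A = mat_inv A * (A * B)" using I assms by (simp only: right_mult_one_mat)
  also have "\<dots> = (mat_inv A * A) * B" using I(1) assms(1,2) by (rule assoc_mult_mat[symmetric])
  also have "\<dots> = B" using I assms by simp
  finally show ?thesis .
qed

lemma flip_mat_inv:
  assumes "A \<in> carrier_mat n n" "invertible_mat A"
  shows "mat_inv (flip A) = flip (mat_inv A)"
proof -
  note I = mat_inv_invertible[OF assms(2,1)]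
  have "flip A * flip (mat_inv A) = 1\<^sub>m n"
    using flip_mult[OF I(1) assms(1)] I by simp
  then show ?thesis using I assms by (intro mat_inv_eqI) auto
qed

lemma invertible_mat_if_det_nonzero:
  fixes A :: "complex mat"
  assumes "A \<in> carrier_mat n n" "det A \<noteq> 0"
  shows "invertible_mat A"
proof -
  from det_non_zero_imp_unit[OF assms, of "()"]
  obtain B where "B \<in> carrier_mat n n" "B * A = 1\<^sub>m n" "A * B = 1\<^sub>m n"
    by (auto simp: Units_def ring_mat_def)
  then show ?thesis using assms by (auto simp: invertible_mat_def inverts_mat_def)
qed

lemma one_smult [simp]: "1 \<cdot>\<^sub>m A = (A :: complex mat)"
  by (rule eq_matI) auto

lemma smult_smult_times: "a \<cdot>\<^sub>m (b \<cdot>\<^sub>m A) = (a * b) \<cdot>\<^sub>m (A :: complex mat)"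
  by (rule eq_matI) auto

section \<open>The resolvent of the triangular matrices\<close>

lemma A_cal_carrier [simp]: "A_cal m p \<in> carrier_mat (m p) (m p)"
  by (simp add: A_cal_def)

lemma A_cal_shift_carrier [simp]: "A_cal m p - z \<cdot>\<^sub>m 1\<^sub>m (m p) \<in> carrier_mat (m p) (m p)"
  by (rule minus_carrier_mat) simp

lemma A_cal_adjoint_shift_carrier [simp]:
  "mat_adjoint (A_cal m p) - z \<cdot>\<^sub>m 1\<^sub>m (m p) \<in> carrier_mat (m p) (m p)"
  by (rule minus_carrier_mat) simp

lemma invertible_A_cal_shift:
  assumes "z \<noteq> \<i>/2"
  shows "invertible_mat (A_cal m p - z \<cdot>\<^sub>m 1\<^sub>m (m p))" (is "invertible_mat ?A")
proof (rule invertible_mat_if_det_nonzero[OF A_cal_shift_carrier])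
  have "det ?A = prod_list (diag_mat ?A)"
    by (rule det_lower_triangular[OF _ A_cal_shift_carrier]) (simp add: A_cal_def)
  also have "diag_mat ?A = map (\<lambda>i. \<i>/2 - z) [0..<m p]"
    by (auto simp: diag_mat_def A_cal_def intro!: map_cong)
  finally show "det ?A \<noteq> 0" using assms by (auto simp: prod_list_zero_iff)
qed

lemma invertible_A_cal_adjoint_shift:
  assumes "z \<noteq> - \<i>/2"
  shows "invertible_mat (mat_adjoint (A_cal m p) - z \<cdot>\<^sub>m 1\<^sub>m (m p))" (is "invertible_mat ?A")
proof (rule invertible_mat_if_det_nonzero[OF A_cal_adjoint_shift_carrier])
  have "det ?A = prod_list (diag_mat ?A)"
    by (rule det_upper_triangular[of _ "m p"]) (auto simp: A_cal_def mat_adjoint_index)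
  also have "diag_mat ?A = map (\<lambda>i. - \<i>/2 - z) [0..<m p]"
    by (auto simp: diag_mat_def A_cal_def mat_adjoint_index intro!: map_cong)
  moreover have "- \<i>/2 - z \<noteq> 0" using assms by (metis eq_iff_diff_eq_0)
  ultimately show "det ?A \<noteq> 0" by (auto simp: prod_list_zero_iff)
qed

lemma flip_A_cal: "flip (A_cal m p) = A_cal m p"
  by (rule eq_matI) (auto simp: flip_def A_cal_def)

lemma flip_A_cal_resolvent:
  assumes "z \<noteq> \<i>/2"
  shows "flip (mat_inv (A_cal m p - z \<cdot>\<^sub>m 1\<^sub>m (m p))) = mat_inv (A_cal m p - z \<cdot>\<^sub>m 1\<^sub>m (m p))"
  using flip_mat_inv[OF A_cal_shift_carrier invertible_A_cal_shift[OF assms], of m p]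
  by (simp add: flip_minus[of _ "m p" "m p"] flip_A_cal flip_smult)

text \<open>The recursion behind forward substitution in \<open>(A - z) y = 1\<close>, where \<open>A\<close> has \<open>\<i>/2\<close> on the diagonal and
\<open>\<i>\<close> below it: what the first \<open>j\<close> unknowns leave of the right-hand side is multiplied by
\<open>1 - \<i> / (\<i>/2 - z) = (z + \<i>/2) / (z - \<i>/2)\<close> in each step.\<close>

lemma geometric_partial_sum:
  fixes z :: complex
  assumes "z \<noteq> \<i>/2"
  shows "1 - \<i> * (\<Sum>l<j. ((z + \<i>/2) / (z - \<i>/2)) ^ l / (\<i>/2 - z)) = ((z + \<i>/2) / (z - \<i>/2)) ^ j"
proof (induction j)
  case (Suc j)
  define r where "r = (z + \<i>/2) / (z - \<i>/2)"
  have nz: "z - \<i>/2 \<noteq> 0" "\<i>/2 - z \<noteq> 0" using assms by auto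
  have r: "1 - \<i> / (\<i>/2 - z) = r"
    using nz by (simp add: r_def divide_simps, simp add: algebra_simps)
  have "1 - \<i> * (\<Sum>l<Suc j. r ^ l / (\<i>/2 - z)) = r ^ j - \<i> * (r ^ j / (\<i>/2 - z))"
    using Suc by (simp add: r_def[symmetric] algebra_simps)
  also have "\<dots> = r ^ j * (1 - \<i> / (\<i>/2 - z))" by (simp add: algebra_simps)
  finally show ?case unfolding r r_def by simp
qed simp

lemma A_cal_resolvent_mult_ones:
  assumes z: "z \<noteq> \<i>/2"
  shows "mat_inv (A_cal m p - z \<cdot>\<^sub>m 1\<^sub>m (m p)) * ones_col (m p) =
    mat (m p) 1 (\<lambda>(j, _). ((z + \<i>/2) / (z - \<i>/2)) ^ j / (\<i>/2 - z))" (is "mat_inv ?A * _ = ?y")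
proof -
  let ?y' = "\<lambda>j. ((z + \<i>/2) / (z - \<i>/2)) ^ j / (\<i>/2 - z)"
  note I = mat_inv_invertible[OF invertible_A_cal_shift[OF z] A_cal_shift_carrier, of m p]
  have y: "?y \<in> carrier_mat (m p) 1" by simp
  have "?A * ?y = ones_col (m p)"
  proof (rule eq_matI)
    fix j k assume "j < dim_row (ones_col (m p))" "k < dim_col (ones_col (m p))"
    then have jk: "j < m p" "k = 0" by auto
    have "(?A * ?y) $$ (j, k) = (\<Sum>l<m p. (if l < j then \<i> else if l = j then \<i>/2 - z else 0) * ?y' l)"
      using jk by (auto simp: scalar_prod_def A_cal_def lessThan_atLeast0 intro!: sum.cong)
    also have "\<dots> = (\<Sum>l<Suc j. (if l < j then \<i> else if l = j then \<i>/2 - z else 0) * ?y' l)"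
      using jk by (intro sum.mono_neutral_right) auto
    also have "\<dots> = \<i> * (\<Sum>l<j. ?y' l) + (\<i>/2 - z) * ?y' j"
      by (simp add: sum_distrib_left)
    also have "(\<i>/2 - z) * ?y' j = 1 - \<i> * (\<Sum>l<j. ?y' l)"
      using z by (simp add: geometric_partial_sum[OF z])
    finally show "(?A * ?y) $$ (j, k) = ones_col (m p) $$ (j, k)"
      using jk by (simp add: ones_col_def)
  qed auto
  then have "mat_inv ?A * ones_col (m p) = mat_inv ?A * (?A * ?y)" by simp
  also have "\<dots> = (mat_inv ?A * ?A) * ?y"
    using I(1) A_cal_shift_carrier y by (rule assoc_mult_mat[symmetric])
  also have "\<dots> = ?y" using I(3) left_mult_one_mat[OF y] by simp
  finally show ?thesis .
qed

lemma add_half_imaginary_unit_nonzero: "z \<noteq> - \<i>/2 \<Longrightarrow> z + \<i>/2 \<noteq> 0" for z :: complex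
  by (metis add_eq_0_iff2 minus_divide_left)

definition resolvent_row :: "(nat \<Rightarrow> nat) \<Rightarrow> nat \<Rightarrow> complex \<Rightarrow> complex mat" where
  "resolvent_row m p z = mat_adjoint (ones_col (m p)) * mat_inv (A_cal m p - z \<cdot>\<^sub>m 1\<^sub>m (m p))"

text \<open>The factor of \<open>q\<close> that belongs to the direction \<open>p\<close>.\<close>

definition cayley_power :: "(nat \<Rightarrow> nat) \<Rightarrow> nat \<Rightarrow> complex \<Rightarrow> complex" where
  "cayley_power m p z = ((z - \<i>/2) / (z + \<i>/2)) ^ m p"

lemma resolvent_row_carrier [simp]: "z \<noteq> \<i>/2 \<Longrightarrow> resolvent_row m p z \<in> carrier_mat 1 (m p)"
  unfolding resolvent_row_def
  by (rule mult_carrier_mat[OF mat_adjoint_ones_carrier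
    mat_inv_invertible(1)[OF invertible_A_cal_shift A_cal_shift_carrier]])

lemma flip_resolvent_row:
  assumes "z \<noteq> \<i>/2"
  shows "flip (resolvent_row m p z) = mat_inv (A_cal m p - z \<cdot>\<^sub>m 1\<^sub>m (m p)) * ones_col (m p)"
  unfolding resolvent_row_def
  by (subst flip_mult[OF mat_adjoint_ones_carrier
      mat_inv_invertible(1)[OF invertible_A_cal_shift[OF assms] A_cal_shift_carrier]])
    (simp add: flip_A_cal_resolvent[OF assms] flip_ones_col[symmetric])

text \<open>The number \<open>s = 1\<^sup>* (A - z)\<^sup>-\<^sup>1 1\<close> enters only through \<open>1 - \<i> * s\<close>, which by the matrix determinant
lemma is the ratio of the determinants of \<open>A\<^sup>* - z\<close> and \<open>A - z\<close>.\<close>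

lemma resolvent_row_mult_ones:
  assumes z: "z \<noteq> \<i>/2"
  obtains s where "resolvent_row m p z * ones_col (m p) = s \<cdot>\<^sub>m 1\<^sub>m 1"
    "1 - \<i> * s = ((z + \<i>/2) / (z - \<i>/2)) ^ m p"
proof
  let ?s = "\<Sum>l<m p. ((z + \<i>/2) / (z - \<i>/2)) ^ l / (\<i>/2 - z)"
  have "resolvent_row m p z * ones_col (m p) =
      mat_adjoint (ones_col (m p)) * (mat_inv (A_cal m p - z \<cdot>\<^sub>m 1\<^sub>m (m p)) * ones_col (m p))"
    unfolding resolvent_row_def
    by (rule assoc_mult_mat[OF mat_adjoint_ones_carrier
      mat_inv_invertible(1)[OF invertible_A_cal_shift[OF z] A_cal_shift_carrier] ones_col_carrier])
  also have "\<dots> = ?s \<cdot>\<^sub>m 1\<^sub>m 1"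
    unfolding A_cal_resolvent_mult_ones[OF z]
    by (rule eq_matI) (auto simp: scalar_prod_def mat_adjoint_index ones_col_def lessThan_atLeast0)
  finally show "resolvent_row m p z * ones_col (m p) = ?s \<cdot>\<^sub>m 1\<^sub>m 1" .
qed (rule geometric_partial_sum[OF z])

lemma A_cal_adjoint:
  "mat_adjoint (A_cal m p) = A_cal m p - \<i> \<cdot>\<^sub>m (ones_col (m p) * mat_adjoint (ones_col (m p)))"
  by (rule eq_matI) (auto simp: A_cal_def mat_adjoint_index ones_col_def scalar_prod_def)

text \<open>With \<open>x = 1\<^sup>* (A - z)\<^sup>-\<^sup>1\<close> and \<open>A\<^sup>* = A - \<i> 1 1\<^sup>*\<close> one has \<open>x (A\<^sup>* - z) = (1 - \<i> * s) 1\<^sup>*\<close> for \<open>s = x 1\<close>,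
which is the Sherman-Morrison formula for a single row; the factor \<open>1 - \<i> * s\<close> is the reciprocal of
the Cayley power.\<close>

lemma adjoint_resolvent_row:
  assumes z: "z \<noteq> \<i>/2" "z \<noteq> - \<i>/2"
  shows "mat_adjoint (ones_col (m p)) * mat_inv (mat_adjoint (A_cal m p) - z \<cdot>\<^sub>m 1\<^sub>m (m p)) =
    cayley_power m p z \<cdot>\<^sub>m resolvent_row m p z"
proof -
  let ?o = "ones_col (m p)" and ?A = "A_cal m p - z \<cdot>\<^sub>m 1\<^sub>m (m p)"
    and ?As = "mat_adjoint (A_cal m p) - z \<cdot>\<^sub>m 1\<^sub>m (m p)" and ?x = "resolvent_row m p z"
  note I = mat_inv_invertible[OF invertible_A_cal_shift[OF z(1)] A_cal_shift_carrier, of m p]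
  note Is = mat_inv_invertible[OF invertible_A_cal_adjoint_shift[OF z(2)] A_cal_adjoint_shift_carrier, of m p]
  obtain s where s: "?x * ?o = s \<cdot>\<^sub>m 1\<^sub>m 1" "1 - \<i> * s = ((z + \<i>/2) / (z - \<i>/2)) ^ m p"
    using resolvent_row_mult_ones[OF z(1)] .
  have x: "?x \<in> carrier_mat 1 (m p)" using z by simp
  have oo: "?o * mat_adjoint ?o \<in> carrier_mat (m p) (m p)"
    by (rule mult_carrier_mat[OF ones_col_carrier mat_adjoint_ones_carrier])
  have xA: "?x * ?A = mat_adjoint ?o"
    unfolding resolvent_row_def
    using assoc_mult_mat[OF mat_adjoint_ones_carrier I(1) A_cal_shift_carrier[of m p z]] I(3) by simp
  have "?As = ?A - \<i> \<cdot>\<^sub>m (?o * mat_adjoint ?o)"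
    unfolding A_cal_adjoint using oo A_cal_carrier[of m p] by (intro eq_matI) auto
  then have "?x * ?As = ?x * ?A - ?x * (\<i> \<cdot>\<^sub>m (?o * mat_adjoint ?o))"
    using mult_minus_distrib_mat[OF x A_cal_shift_carrier[of m p z], of "\<i> \<cdot>\<^sub>m (?o * mat_adjoint ?o)"] oo by simp
  also have "?x * (\<i> \<cdot>\<^sub>m (?o * mat_adjoint ?o)) = \<i> \<cdot>\<^sub>m ((?x * ?o) * mat_adjoint ?o)"
    unfolding mult_smult_distrib[OF x oo] assoc_mult_mat[OF x ones_col_carrier mat_adjoint_ones_carrier] ..
  also have "\<dots> = (\<i> * s) \<cdot>\<^sub>m mat_adjoint ?o"
    unfolding s mult_smult_assoc_mat[OF one_carrier_mat mat_adjoint_ones_carrier]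
    by (simp add: left_mult_one_mat[OF mat_adjoint_ones_carrier] smult_smult_times)
  also have "?x * ?A - (\<i> * s) \<cdot>\<^sub>m mat_adjoint ?o = (1 - \<i> * s) \<cdot>\<^sub>m mat_adjoint ?o"
    unfolding xA by (rule eq_matI) (auto simp: left_diff_distrib)
  finally have xAs: "?x * ?As = (1 - \<i> * s) \<cdot>\<^sub>m mat_adjoint ?o" .
  have "?x = ?x * (?As * mat_inv ?As)" using x by (simp only: Is right_mult_one_mat)
  also have "\<dots> = (?x * ?As) * mat_inv ?As"
    using x A_cal_adjoint_shift_carrier Is(1) by (rule assoc_mult_mat[symmetric])
  also have "\<dots> = (1 - \<i> * s) \<cdot>\<^sub>m (mat_adjoint ?o * mat_inv ?As)"
    unfolding xAs by (rule mult_smult_assoc_mat[OF mat_adjoint_ones_carrier Is(1)])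
  finally have "cayley_power m p z \<cdot>\<^sub>m ?x =
      (cayley_power m p z * (1 - \<i> * s)) \<cdot>\<^sub>m (mat_adjoint ?o * mat_inv ?As)"
    by (metis smult_smult_times)
  moreover have "cayley_power m p z * (1 - \<i> * s) = 1"
  proof -
    have "z - \<i>/2 \<noteq> 0" "z + \<i>/2 \<noteq> 0" using z add_half_imaginary_unit_nonzero by auto
    then show ?thesis unfolding s cayley_power_def by (simp add: power_mult_distrib[symmetric])
  qed
  ultimately show ?thesis by simp
qed

section \<open>Reflection of the functions $u_p$\<close>

lemma mat_inv_kronecker_one:
  assumes "A \<in> carrier_mat a a" "invertible_mat A"
  shows "mat_inv (A \<otimes>\<^sub>K 1\<^sub>m b) = mat_inv A \<otimes>\<^sub>K 1\<^sub>m b"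
    and "mat_inv (1\<^sub>m b \<otimes>\<^sub>K A) = 1\<^sub>m b \<otimes>\<^sub>K mat_inv A"
proof -
  note I = mat_inv_invertible[OF assms(2,1)]
  show "mat_inv (A \<otimes>\<^sub>K 1\<^sub>m b) = mat_inv A \<otimes>\<^sub>K 1\<^sub>m b"
    using assms I
    by (intro mat_inv_eqI[of _ "a * b"]) (simp_all add: kronecker_mult[of _ a a _ a _ b b _ b] kronecker_one)
  show "mat_inv (1\<^sub>m b \<otimes>\<^sub>K A) = 1\<^sub>m b \<otimes>\<^sub>K mat_inv A"
    using assms I
    by (intro mat_inv_eqI[of _ "b * a"]) (simp_all add: kronecker_mult[of _ b b _ b _ a a _ a] kronecker_one)
qed

lemma kronecker_one_shift:
  assumes "A \<in> carrier_mat a a"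
  shows "A \<otimes>\<^sub>K 1\<^sub>m b - z \<cdot>\<^sub>m 1\<^sub>m (a * b) = (A - z \<cdot>\<^sub>m 1\<^sub>m a) \<otimes>\<^sub>K 1\<^sub>m b"
    and "1\<^sub>m b \<otimes>\<^sub>K A - z \<cdot>\<^sub>m 1\<^sub>m (b * a) = 1\<^sub>m b \<otimes>\<^sub>K (A - z \<cdot>\<^sub>m 1\<^sub>m a)"
  using assms
  by (simp_all add: kronecker_minus_left[of _ a a] kronecker_minus_right[of _ a a]
    kronecker_smult_left kronecker_smult_right kronecker_one)

lemma resolvent_product:
  assumes X: "X \<in> carrier_mat a a" "invertible_mat (X - z \<cdot>\<^sub>m 1\<^sub>m a)"
    and Y: "Y \<in> carrier_mat b b" "invertible_mat (Y - w \<cdot>\<^sub>m 1\<^sub>m b)"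
  shows "mat_inv (X \<otimes>\<^sub>K 1\<^sub>m b \<otimes>\<^sub>K 1\<^sub>m c - z \<cdot>\<^sub>m 1\<^sub>m (a * b * c)) *
      mat_inv (1\<^sub>m a \<otimes>\<^sub>K Y \<otimes>\<^sub>K 1\<^sub>m c - w \<cdot>\<^sub>m 1\<^sub>m (a * b * c)) =
    mat_inv (X - z \<cdot>\<^sub>m 1\<^sub>m a) \<otimes>\<^sub>K mat_inv (Y - w \<cdot>\<^sub>m 1\<^sub>m b) \<otimes>\<^sub>K 1\<^sub>m c"
proof -
  have XY: "X - z \<cdot>\<^sub>m 1\<^sub>m a \<in> carrier_mat a a" "Y - w \<cdot>\<^sub>m 1\<^sub>m b \<in> carrier_mat b b"
    by (rule minus_carrier_mat, simp)+
  note IX = mat_inv_invertible(1)[OF X(2) XY(1)] and IY = mat_inv_invertible(1)[OF Y(2) XY(2)]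
  have 1: "mat_inv (X \<otimes>\<^sub>K 1\<^sub>m b \<otimes>\<^sub>K 1\<^sub>m c - z \<cdot>\<^sub>m 1\<^sub>m (a * b * c)) =
      mat_inv (X - z \<cdot>\<^sub>m 1\<^sub>m a) \<otimes>\<^sub>K 1\<^sub>m (b * c)"
    by (simp only: kronecker_one mult.assoc kronecker_one_shift[OF X(1)] mat_inv_kronecker_one[OF XY(1) X(2)])
  have "(1\<^sub>m a \<otimes>\<^sub>K Y) \<otimes>\<^sub>K 1\<^sub>m c - w \<cdot>\<^sub>m 1\<^sub>m (a * b * c) =
      ((1\<^sub>m a \<otimes>\<^sub>K Y) - w \<cdot>\<^sub>m 1\<^sub>m (a * b)) \<otimes>\<^sub>K 1\<^sub>m c"
    by (rule kronecker_one_shift) (use Y in simp)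
  also have "\<dots> = 1\<^sub>m a \<otimes>\<^sub>K ((Y - w \<cdot>\<^sub>m 1\<^sub>m b) \<otimes>\<^sub>K 1\<^sub>m c)"
    by (simp only: kronecker_one_shift[OF Y(1)] kronecker_assoc)
  finally have 2: "1\<^sub>m a \<otimes>\<^sub>K Y \<otimes>\<^sub>K 1\<^sub>m c - w \<cdot>\<^sub>m 1\<^sub>m (a * b * c) =
      1\<^sub>m a \<otimes>\<^sub>K ((Y - w \<cdot>\<^sub>m 1\<^sub>m b) \<otimes>\<^sub>K 1\<^sub>m c)"
    by (simp only: kronecker_assoc)
  have Yc: "(Y - w \<cdot>\<^sub>m 1\<^sub>m b) \<otimes>\<^sub>K 1\<^sub>m c \<in> carrier_mat (b * c) (b * c)"
    by (rule kronecker_carrier[OF XY(2) one_carrier_mat])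
  have "((Y - w \<cdot>\<^sub>m 1\<^sub>m b) \<otimes>\<^sub>K 1\<^sub>m c) * (mat_inv (Y - w \<cdot>\<^sub>m 1\<^sub>m b) \<otimes>\<^sub>K 1\<^sub>m c) = 1\<^sub>m (b * c)"
    "(mat_inv (Y - w \<cdot>\<^sub>m 1\<^sub>m b) \<otimes>\<^sub>K 1\<^sub>m c) * ((Y - w \<cdot>\<^sub>m 1\<^sub>m b) \<otimes>\<^sub>K 1\<^sub>m c) = 1\<^sub>m (b * c)"
    by (simp_all only: kronecker_mult[OF XY(2) IY one_carrier_mat one_carrier_mat]
      kronecker_mult[OF IY XY(2) one_carrier_mat one_carrier_mat]
      mat_inv_invertible[OF Y(2) XY(2)] left_mult_one_mat[OF one_carrier_mat] kronecker_one)
  then have "invertible_mat ((Y - w \<cdot>\<^sub>m 1\<^sub>m b) \<otimes>\<^sub>K 1\<^sub>m c)"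
    using carrier_matD[OF Yc] carrier_matD[OF IY] unfolding invertible_mat_def inverts_mat_def
    by (metis dim_kronecker index_one_mat(2) square_mat.simps)
  note Z = mat_inv_kronecker_one(2)[OF Yc this, of a]
  show ?thesis
    unfolding 1 2 Z mat_inv_kronecker_one(1)[OF XY(2) Y(2)]
    using kronecker_mult[OF IX one_carrier_mat one_carrier_mat kronecker_carrier[OF IY one_carrier_mat[of c]]]
      right_mult_one_mat[OF IX] left_mult_one_mat[OF kronecker_carrier[OF IY one_carrier_mat[of c]]]
    by simp
qed

text \<open>The block row \<open>L\<^sup>* (A_1 - \<mu>_1)\<^sup>-\<^sup>1 (A_2 - \<mu>_2)\<^sup>-\<^sup>1\<close> in factored form.\<close>

definition resolvent_rows :: "(nat \<Rightarrow> nat) \<Rightarrow> (nat \<Rightarrow> complex) \<Rightarrow> complex mat" where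
  "resolvent_rows m \<mu> = resolvent_row m 1 (\<mu> 1) \<otimes>\<^sub>K resolvent_row m 2 (\<mu> 2) \<otimes>\<^sub>K 1\<^sub>m (m 3)"

lemma resolvent_rows_carrier [simp]:
  assumes "\<mu> 1 \<noteq> \<i>/2" "\<mu> 2 \<noteq> \<i>/2"
  shows "resolvent_rows m \<mu> \<in> carrier_mat (m 3) (m 1 * (m 2 * m 3))"
  using kronecker_carrier[OF resolvent_row_carrier[OF assms(1), of m 1]
    kronecker_carrier[OF resolvent_row_carrier[OF assms(2), of m 2] one_carrier_mat[of "m 3"]]]
  by (simp add: resolvent_rows_def)

lemma L_eq: "L m = ones_col (m 1) \<otimes>\<^sub>K ones_col (m 2) \<otimes>\<^sub>K 1\<^sub>m (m 3)"
  by (simp add: L_def ones_col_kronecker[symmetric] kronecker_assoc)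

lemma kronecker_mult3:
  assumes "A \<in> carrier_mat a b" "D \<in> carrier_mat b c" "B \<in> carrier_mat a' b'" "E \<in> carrier_mat b' c'"
  shows "(A \<otimes>\<^sub>K B \<otimes>\<^sub>K 1\<^sub>m n) * (D \<otimes>\<^sub>K E \<otimes>\<^sub>K 1\<^sub>m n) = (A * D) \<otimes>\<^sub>K (B * E) \<otimes>\<^sub>K 1\<^sub>m n"
  using kronecker_mult[OF assms(1,2) kronecker_carrier[OF assms(3) one_carrier_mat]
      kronecker_carrier[OF assms(4) one_carrier_mat], of n]
    kronecker_mult[OF assms(3,4) one_carrier_mat one_carrier_mat, of n]
  by simp

text \<open>The passage from the resolvents of the adjoints, which occur in \<open>v\<close>, to those of the matrices
themselves, which occur in \<open>v_hat\<close>, costs exactly the scalar \<open>q\<close>.\<close>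

lemma adjoint_L_resolvents:
  assumes "\<mu> 1 \<notin> {\<i>/2, -\<i>/2}" "\<mu> 2 \<notin> {\<i>/2, -\<i>/2}"
  shows "mat_adjoint (L m) *
      (mat_inv (mat_adjoint (A1 m) - \<mu> 1 \<cdot>\<^sub>m 1\<^sub>m (m 1 * m 2 * m 3)) *
       mat_inv (mat_adjoint (A2 m) - \<mu> 2 \<cdot>\<^sub>m 1\<^sub>m (m 1 * m 2 * m 3))) =
    q m \<mu> \<cdot>\<^sub>m resolvent_rows m \<mu>"
proof -
  have z: "\<mu> 1 \<noteq> \<i>/2" "\<mu> 1 \<noteq> -\<i>/2" "\<mu> 2 \<noteq> \<i>/2" "\<mu> 2 \<noteq> -\<i>/2" using assms by auto
  note I = invertible_A_cal_adjoint_shift[OF z(2), of m 1] invertible_A_cal_adjoint_shift[OF z(4), of m 2]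
  note C = mat_inv_invertible(1)[OF I(1) A_cal_adjoint_shift_carrier]
    mat_inv_invertible(1)[OF I(2) A_cal_adjoint_shift_carrier]
  have A: "mat_adjoint (A_cal m p) \<in> carrier_mat (m p) (m p)" for p
    by (rule carrier_matI) (simp_all add: A_cal_def)
  have "q m \<mu> = cayley_power m 1 (\<mu> 1) * cayley_power m 2 (\<mu> 2)"
    by (simp add: q_def cayley_power_def)
  then show ?thesis
    unfolding A1_def A2_def L_eq mat_adjoint_kronecker mat_adjoint_one
      resolvent_product[OF A I(1) A I(2)]
      kronecker_mult3[OF mat_adjoint_ones_carrier C(1) mat_adjoint_ones_carrier C(2)]
      adjoint_resolvent_row[OF z(1,2)] adjoint_resolvent_row[OF z(3,4)] resolvent_rows_def
    by (simp add: kronecker_smult_left kronecker_smult_right smult_smult_times mult.commute)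
qed

lemma resolvents_mult_L:
  assumes "\<mu> 1 \<noteq> \<i>/2" "\<mu> 2 \<noteq> \<i>/2"
  shows "mat_inv (A1 m - \<mu> 1 \<cdot>\<^sub>m 1\<^sub>m (m 1 * m 2 * m 3)) * mat_inv (A2 m - \<mu> 2 \<cdot>\<^sub>m 1\<^sub>m (m 1 * m 2 * m 3))
      \<in> carrier_mat (m 1 * (m 2 * m 3)) (m 1 * (m 2 * m 3))" (is "?C \<in> _")
    and "mat_inv (A1 m - \<mu> 1 \<cdot>\<^sub>m 1\<^sub>m (m 1 * m 2 * m 3)) * mat_inv (A2 m - \<mu> 2 \<cdot>\<^sub>m 1\<^sub>m (m 1 * m 2 * m 3)) * L m
      = flip (resolvent_rows m \<mu>)"
proof -
  note I = invertible_A_cal_shift[OF assms(1), of m 1] invertible_A_cal_shift[OF assms(2), of m 2]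
  note C = mat_inv_invertible(1)[OF I(1) A_cal_shift_carrier]
    mat_inv_invertible(1)[OF I(2) A_cal_shift_carrier]
  note P = resolvent_product[OF A_cal_carrier I(1) A_cal_carrier I(2), of "m 3"]
  show "?C \<in> carrier_mat (m 1 * (m 2 * m 3)) (m 1 * (m 2 * m 3))"
    unfolding A1_def A2_def P
    by (rule kronecker_carrier[OF C(1) kronecker_carrier[OF C(2) one_carrier_mat]])
  show "?C * L m = flip (resolvent_rows m \<mu>)"
    unfolding A1_def A2_def P L_eq kronecker_mult3[OF C(1) ones_col_carrier C(2) ones_col_carrier]
      resolvent_rows_def flip_kronecker flip_resolvent_row[OF assms(1)] flip_resolvent_row[OF assms(2)]
    by simp
qed

lemma resolvent_rows_mult_M31:
  assumes z: "\<mu> 1 \<noteq> \<i>/2" "\<mu> 2 \<noteq> \<i>/2" and s: "resolvent_row m 1 (\<mu> 1) * ones_col (m 1) = s \<cdot>\<^sub>m 1\<^sub>m 1"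
  shows "resolvent_rows m \<mu> * M31 m = s \<cdot>\<^sub>m (resolvent_row m 2 (\<mu> 2) \<otimes>\<^sub>K 1\<^sub>m (m 3))"
proof -
  note C = resolvent_row_carrier[OF z(1), of m 1] resolvent_row_carrier[OF z(2), of m 2]
  show ?thesis
    unfolding resolvent_rows_def M31_eq kronecker_one[symmetric]
      kronecker_mult3[OF C(1) ones_col_carrier C(2) one_carrier_mat] s right_mult_one_mat[OF C(2)]
    by (simp add: kronecker_smult_left)
qed

lemma resolvent_rows_mult_M32:
  assumes z: "\<mu> 1 \<noteq> \<i>/2" "\<mu> 2 \<noteq> \<i>/2" and s: "resolvent_row m 2 (\<mu> 2) * ones_col (m 2) = s \<cdot>\<^sub>m 1\<^sub>m 1"
  shows "resolvent_rows m \<mu> * M32 m = s \<cdot>\<^sub>m (resolvent_row m 1 (\<mu> 1) \<otimes>\<^sub>K 1\<^sub>m (m 3))"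
proof -
  note C = resolvent_row_carrier[OF z(1), of m 1] resolvent_row_carrier[OF z(2), of m 2]
  show ?thesis
    unfolding resolvent_rows_def M32_eq
      kronecker_mult3[OF C(1) one_carrier_mat C(2) ones_col_carrier] s right_mult_one_mat[OF C(1)]
    by (simp add: kronecker_smult_left kronecker_smult_right)
qed

text \<open>The reflection formula for \<open>u_p\<close> with everything abstracted away but the relation
\<open>T M_3 = M_1 + flip M_4\<close>. Here \<open>a\<close> stands for \<open>q\<close>, \<open>Y\<close> for the row of resolvents, and \<open>E\<close> and \<open>b\<close> for
the resolvent row and the Cayley power of the complementary direction \<open>k\<close>. Reflecting the second
block of \<open>u_hat\<close> gives \<open>- Y R M_1\<close> together with the multiple \<open>s + \<i>\<close> of \<open>E\<close>, where \<open>s E = Y M_3\<close>, and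
\<open>- a * (s + \<i>) = - \<i> * b\<close> is the coefficient of \<open>E\<close> in \<open>u\<close>.\<close>

lemma u_reflection_core:
  fixes s a b :: complex
  assumes T: "T \<in> carrier_mat n n" and R: "R \<in> carrier_mat n n" "flip R = R" "R * T = 1\<^sub>m n"
    and M: "M1 \<in> carrier_mat n (m k * m 3)" "M3 \<in> carrier_mat n (m k * m 3)" "M4 \<in> carrier_mat (m k * m 3) n"
    and TM: "T * M3 = M1 + flip M4"
    and Y: "Y \<in> carrier_mat (m 3) n" and E: "E \<in> carrier_mat (m 3) (m k * m 3)"
    and YM: "Y * M3 = s \<cdot>\<^sub>m E" and ab: "b = a * (1 - \<i> * s)"
  shows "a \<cdot>\<^sub>m (Y * (R * (M1 @\<^sub>c M3))) -
      \<i> \<cdot>\<^sub>m ((b \<cdot>\<^sub>m E) * (1\<^sub>m (m k * m 3) @\<^sub>c 0\<^sub>m (m k * m 3) (m k * m 3))) =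
    (- a) \<cdot>\<^sub>m (U m 3 * transpose_mat ((flip M3 @\<^sub>r M4) * R * flip Y +
      \<i> \<cdot>\<^sub>m ((0\<^sub>m (m k * m 3) (m k * m 3) @\<^sub>r 1\<^sub>m (m k * m 3)) * flip E)) * Utilde m k)"
    (is "?lhs = ?rhs")
proof -
  define N where "N = m k * m 3"
  define c where "c = m 3"
  define Z where "Z = Y * (R * M1)"
  define W where "W = Y * (R * M3)"
  note M' = M[folded N_def] and Y' = Y[folded c_def] and E' = E[folded c_def N_def]
  have ZW: "Z \<in> carrier_mat c N" "W \<in> carrier_mat c N" using M' Y' R by (auto simp: Z_def W_def)
  have RM: "R * flip M4 = M3 - R * M1"
  proof -
    have "M3 = R * (T * M3)" using assoc_mult_mat[OF R(1) T M'(2)] R(3) M' by simp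
    also have "\<dots> = R * M1 + R * flip M4"
      unfolding TM using M' R by (intro mult_add_distrib_mat[of _ n n]) auto
    finally show ?thesis using M' R by (intro eq_matI) auto
  qed
  have fP: "flip (flip M3 * R * flip Y) = W"
  proof -
    have "flip (flip M3 * R * flip Y) = flip (flip Y) * flip (flip M3 * R)"
      using M' R Y' by (intro flip_mult[of _ N n _ c]) auto
    also have "flip (flip M3 * R) = R * M3"
      using M' R by (simp add: flip_mult[of _ N n _ n])
    finally show ?thesis by (simp add: W_def)
  qed
  have fQ: "flip (M4 * R * flip Y) = s \<cdot>\<^sub>m E - Z"
  proof -
    have "flip (M4 * R * flip Y) = flip (flip Y) * flip (M4 * R)"
      using M' R Y' by (intro flip_mult[of _ N n _ c]) auto
    also have "flip (M4 * R) = M3 - R * M1"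
      using M' R by (simp add: flip_mult[of _ N n _ n] RM)
    also have "flip (flip Y) * (M3 - R * M1) = s \<cdot>\<^sub>m E - Z"
      using M' R Y' by (simp add: mult_minus_distrib_mat[of _ c n _ N] YM Z_def)
    finally show ?thesis .
  qed
  have PQ: "flip M3 * R * flip Y \<in> carrier_mat N c" "M4 * R * flip Y \<in> carrier_mat N c"
    using M' R Y' by auto
  have fE: "flip E \<in> carrier_mat N c" using E' by simp
  have iE: "\<i> \<cdot>\<^sub>m flip E \<in> carrier_mat N c" using E' by simp
  have 1: "(flip M3 @\<^sub>r M4) * R * flip Y = (flip M3 * R * flip Y) @\<^sub>r (M4 * R * flip Y)"
  proof -
    have "flip M3 \<in> carrier_mat N n" "flip Y \<in> carrier_mat n c" using M' Y' by auto
    then show ?thesis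
      using M'(3) R(1)
      by (simp only: append_rows_mult[of R n n "flip M3" N M4 N]
        append_rows_mult[of "flip Y" n c "flip M3 * R" N "M4 * R" N] mult_carrier_mat)
  qed
  have 2: "(0\<^sub>m N N @\<^sub>r 1\<^sub>m N) * flip E = 0\<^sub>m N c @\<^sub>r flip E"
    using append_rows_mult[OF fE zero_carrier_mat one_carrier_mat]
    by (simp add: left_mult_one_mat[OF fE] left_mult_zero_mat[OF fE])
  have 3: "((flip M3 * R * flip Y) @\<^sub>r (M4 * R * flip Y)) + \<i> \<cdot>\<^sub>m (0\<^sub>m N c @\<^sub>r flip E) =
      (flip M3 * R * flip Y) @\<^sub>r (M4 * R * flip Y + \<i> \<cdot>\<^sub>m flip E)"
  proof -
    have dims: "0\<^sub>m N c @\<^sub>r flip E \<in> carrier_mat (N + N) c"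
      "(flip M3 * R * flip Y) @\<^sub>r (M4 * R * flip Y) \<in> carrier_mat (N + N) c"
      "(flip M3 * R * flip Y) @\<^sub>r (M4 * R * flip Y + \<i> \<cdot>\<^sub>m flip E) \<in> carrier_mat (N + N) c"
      using PQ fE by (auto intro!: carrier_append_rows)
    have Q2: "M4 * R * flip Y + \<i> \<cdot>\<^sub>m flip E \<in> carrier_mat N c" using PQ fE by simp
    show ?thesis
      by (rule eq_matI)
        (use carrier_matD[OF dims(1)] carrier_matD[OF dims(2)] carrier_matD[OF dims(3)]
          carrier_matD[OF PQ(1)] carrier_matD[OF PQ(2)] carrier_matD[OF fE] in
          \<open>auto simp: append_rows_index[OF PQ] append_rows_index[OF zero_carrier_mat fE]
             append_rows_index[OF PQ(1) Q2] simp del: index_mult_mat dim_flip\<close>)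
  qed
  have "exchange c * transpose_mat ((flip M3 * R * flip Y) @\<^sub>r (M4 * R * flip Y + \<i> \<cdot>\<^sub>m flip E)) * Utilde m k =
      flip (M4 * R * flip Y + \<i> \<cdot>\<^sub>m flip E) @\<^sub>c (- W)"
    using exchange_transpose_Utilde[where m = m and k = k, folded N_def, OF PQ(1) add_carrier_mat[OF iE]] fP by simp
  then have "?rhs = (- a) \<cdot>\<^sub>m (flip (M4 * R * flip Y + \<i> \<cdot>\<^sub>m flip E) @\<^sub>c (- W))"
    unfolding N_def[symmetric] U_eq_exchange unfolding c_def[symmetric] 1 2 3 by simp
  also have "flip (M4 * R * flip Y + \<i> \<cdot>\<^sub>m flip E) = s \<cdot>\<^sub>m E - Z + \<i> \<cdot>\<^sub>m E"
    by (simp add: flip_add[OF PQ(2) iE] fQ flip_smult)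
  finally have rhs: "?rhs = (- a) \<cdot>\<^sub>m ((s \<cdot>\<^sub>m E - Z + \<i> \<cdot>\<^sub>m E) @\<^sub>c (- W))" .
  have "Y * (R * (M1 @\<^sub>c M3)) = Z @\<^sub>c W"
    using M' R Y' by (simp add: mult_append_cols[of _ n n _ N _ N] mult_append_cols[of _ c n _ N _ N] Z_def W_def)
  moreover have bE: "b \<cdot>\<^sub>m E \<in> carrier_mat c N" using E' by simp
  have "(b \<cdot>\<^sub>m E) * (1\<^sub>m N @\<^sub>c 0\<^sub>m N N) = (b \<cdot>\<^sub>m E) @\<^sub>c 0\<^sub>m c N"
    unfolding mult_append_cols[OF bE one_carrier_mat zero_carrier_mat]
      right_mult_one_mat[OF bE] right_mult_zero_mat[OF bE] ..
  ultimately have lhs: "?lhs = a \<cdot>\<^sub>m (Z @\<^sub>c W) - \<i> \<cdot>\<^sub>m ((b \<cdot>\<^sub>m E) @\<^sub>c 0\<^sub>m c N)"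
    by (simp add: N_def c_def)
  have F: "s \<cdot>\<^sub>m E - Z + \<i> \<cdot>\<^sub>m E \<in> carrier_mat c N" "- W \<in> carrier_mat c N" using E' ZW by auto
  note D = carrier_matD[OF append_cols_carrier[OF F]] carrier_matD[OF append_cols_carrier[OF ZW]]
    carrier_matD[OF append_cols_carrier[OF bE zero_carrier_mat[of c N]]]
  show ?thesis
    unfolding lhs rhs
    by (rule eq_matI,
      use E' ZW in \<open>auto simp: D append_cols_index[OF F] append_cols_index[OF ZW]
        append_cols_index[OF bE zero_carrier_mat]\<close>,
      simp add: ab algebra_simps)
qed

lemma v_eq:
  assumes "\<mu> 1 \<notin> {\<i>/2, -\<i>/2}" "\<mu> 2 \<notin> {\<i>/2, -\<i>/2}"
    and "Gam m \<tau> p \<in> carrier_mat (m 1 * (m 2 * m 3)) d"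
  shows "v m \<tau> p \<mu> = q m \<mu> \<cdot>\<^sub>m (resolvent_rows m \<mu> * Gam m \<tau> p)"
  unfolding v_def Let_def adjoint_L_resolvents[OF assms(1,2)]
  using assms by (intro mult_smult_assoc_mat[OF resolvent_rows_carrier]) auto

lemma v_hat_eq:
  assumes "\<mu> 1 \<noteq> \<i>/2" "\<mu> 2 \<noteq> \<i>/2"
    and G: "Gam_hat m \<tau> p \<in> carrier_mat d (m 1 * (m 2 * m 3))"
  shows "v_hat m \<tau> p \<mu> = Gam_hat m \<tau> p * flip (resolvent_rows m \<mu>)"
proof -
  have "L m \<in> carrier_mat (m 1 * (m 2 * m 3)) (m 3)"
    by (rule carrier_matI) (simp_all add: L_eq)
  from assoc_mult_mat[OF G resolvents_mult_L(1)[of \<mu> m, OF assms(1,2)] this]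
  show ?thesis unfolding v_hat_def Let_def resolvents_mult_L(2)[OF assms(1,2)] .
qed

section \<open>The off-diagonal blocks of $G$\<close>

lemma Lp_mult_adjoint: "Lp m i * mat_adjoint (Lp m j) =
    (ones_col (m i) * mat_adjoint (ones_col (m j))) \<otimes>\<^sub>K 1\<^sub>m (m 3)"
  unfolding Lp_def mat_adjoint_kronecker mat_adjoint_one
    kronecker_mult[OF ones_col_carrier mat_adjoint_ones_carrier one_carrier_mat one_carrier_mat]
  by simp

lemma Lp_mult_adjoint_carrier:
  "Lp m i * mat_adjoint (Lp m j) \<in> carrier_mat (m i * m 3) (m j * m 3)"
  by (rule carrier_matI) (simp_all add: Lp_def)

lemma flip_Lp_mult_adjoint:
  "flip (Lp m i * mat_adjoint (Lp m j)) = Lp m j * mat_adjoint (Lp m i)"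
  unfolding Lp_mult_adjoint flip_kronecker flip_mult[OF ones_col_carrier mat_adjoint_ones_carrier]
  by (simp add: flip_ones_col[symmetric])

lemma ones_kronecker_ones_adjoint:
  "ones_col a \<otimes>\<^sub>K mat_adjoint (ones_col b) = ones_col a * mat_adjoint (ones_col b)"
  by (rule eq_matI) (auto simp: kronecker_index mat_adjoint_index ones_col_def scalar_prod_def)

lemma M22_mult_M31: "M22 m * M31 m = Lp m 1 * mat_adjoint (Lp m 2)"
  unfolding M22_def M31_eq kronecker_one[symmetric]
    kronecker_mult3[OF one_carrier_mat ones_col_carrier mat_adjoint_ones_carrier one_carrier_mat]
    Lp_mult_adjoint ones_kronecker_ones_adjoint[symmetric]
    left_mult_one_mat[OF ones_col_carrier] right_mult_one_mat[OF mat_adjoint_ones_carrier]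
  by (rule kronecker_assoc[symmetric])

lemma four_block_minus_left_column:
  fixes P :: "complex mat"
  assumes "P \<in> carrier_mat r c" "Q \<in> carrier_mat r d" "P' \<in> carrier_mat s c" "Q' \<in> carrier_mat s d"
    and "X \<in> carrier_mat r c" "Y \<in> carrier_mat s c"
  shows "four_block_mat P Q P' Q' - four_block_mat X (0\<^sub>m r d) Y (0\<^sub>m s d) =
    four_block_mat (P - X) Q (P' - Y) Q'"
  using assms by (intro eq_matI) auto

lemma eq_minus_if_eq_add:
  fixes A :: "complex mat"
  assumes "C = A + B" "A \<in> carrier_mat r c" "B \<in> carrier_mat r c"
  shows "A = C - B"
  using assms by (intro eq_matI) auto

lemma minus_minus_cancel:
  fixes A :: "complex mat"
  assumes "A \<in> carrier_mat r c" "B \<in> carrier_mat r c"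
  shows "A - B - A = - B"
  using assms by (intro eq_matI) auto

lemma uminus_minus:
  fixes A :: "complex mat"
  assumes "A \<in> carrier_mat r c" "B \<in> carrier_mat r c"
  shows "- (A - B) = B - A"
  using assms by (intro eq_matI) auto

lemma add_minus_cancel:
  fixes A :: "complex mat"
  assumes "A \<in> carrier_mat r c" "B \<in> carrier_mat r c" "C \<in> carrier_mat r c" "D \<in> carrier_mat r c"
  shows "A + B - (C + B - D) - A = D - C"
  using assms by (intro eq_matI) auto

lemma transpose_mat_smult: "transpose_mat (a \<cdot>\<^sub>m A) = a \<cdot>\<^sub>m transpose_mat (A :: complex mat)"
  by (rule eq_matI) auto

context
  fixes m :: "nat \<Rightarrow> nat" and \<tau> :: "int \<Rightarrow> int \<Rightarrow> int \<Rightarrow> complex"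
  assumes inv: "invertible_mat (toeplitz3 m \<tau>)"
begin

abbreviation "R \<equiv> mat_inv (toeplitz3 m \<tau>)"
abbreviation "n \<equiv> m 1 * (m 2 * m 3)"

lemmas R = mat_inv_invertible[OF inv toeplitz3_carrier]

lemma flip_R: "flip R = R"
  using flip_mat_inv[OF toeplitz3_carrier inv] by (simp add: flip_toeplitz3)

lemma u_reflection_1:
  assumes \<mu>: "\<mu> 1 \<notin> {\<i>/2, -\<i>/2}" "\<mu> 2 \<notin> {\<i>/2, -\<i>/2}"
  shows "u m \<tau> 1 \<mu> = (- q m \<mu>) \<cdot>\<^sub>m (U m 3 * transpose_mat (u_hat m \<tau> 1 \<mu>) * Utilde m 2)"
proof -
  have z: "\<mu> 1 \<noteq> \<i>/2" "\<mu> 2 \<noteq> \<i>/2" "\<mu> 1 \<noteq> -\<i>/2" "\<mu> 2 \<noteq> -\<i>/2" using \<mu> by auto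
  have k: "3 - 1 = (2 :: nat)" by simp
  have Gam: "Gam m \<tau> 1 = R * (M11 m \<tau> @\<^sub>c M31 m)" by (simp add: Gam_def Pi_mat_def)
  have Gam_hat: "Gam_hat m \<tau> 1 = (flip (M31 m) @\<^sub>r M41 m \<tau>) * R"
    by (simp add: Gam_hat_def Pi_hat_def M21_eq)
  have Gc: "Gam m \<tau> 1 \<in> carrier_mat n (m 2 * m 3 + m 2 * m 3)"
    unfolding Gam by (rule mult_carrier_mat[OF R(1)]) simp
  have Ghc: "Gam_hat m \<tau> 1 \<in> carrier_mat (m 2 * m 3 + m 2 * m 3) n"
    unfolding Gam_hat by (rule mult_carrier_mat[OF _ R(1)]) simp
  let ?x = "resolvent_row m 2 (\<mu> 2)"
  have E: "?x \<otimes>\<^sub>K 1\<^sub>m (m 3) \<in> carrier_mat (m 3) (m 2 * m 3)"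
    using kronecker_carrier[OF resolvent_row_carrier[OF z(2), of m 2] one_carrier_mat[of "m 3"]] by simp
  obtain s where s: "resolvent_row m 1 (\<mu> 1) * ones_col (m 1) = s \<cdot>\<^sub>m 1\<^sub>m 1"
    "1 - \<i> * s = ((\<mu> 1 + \<i>/2) / (\<mu> 1 - \<i>/2)) ^ m 1"
    using resolvent_row_mult_ones[OF z(1)] .
  have nz: "\<mu> 1 - \<i>/2 \<noteq> 0" "\<mu> 1 + \<i>/2 \<noteq> 0" using z add_half_imaginary_unit_nonzero by auto
  then have c: "cayley_power m 2 (\<mu> 2) = q m \<mu> * (1 - \<i> * s)"
    unfolding s q_def cayley_power_def by (simp add: power_divide)
  have u: "u m \<tau> 1 \<mu> = q m \<mu> \<cdot>\<^sub>m (resolvent_rows m \<mu> * (R * (M11 m \<tau> @\<^sub>c M31 m))) -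
      \<i> \<cdot>\<^sub>m ((cayley_power m 2 (\<mu> 2) \<cdot>\<^sub>m (?x \<otimes>\<^sub>K 1\<^sub>m (m 3))) *
        (1\<^sub>m (m 2 * m 3) @\<^sub>c 0\<^sub>m (m 2 * m 3) (m 2 * m 3)))"
    unfolding u_def k Let_def v_eq[OF \<mu> Gc] Gam adjoint_resolvent_row[OF z(2,4)] kronecker_smult_left ..
  have uh: "u_hat m \<tau> 1 \<mu> = (flip (M31 m) @\<^sub>r M41 m \<tau>) * R * flip (resolvent_rows m \<mu>) +
      \<i> \<cdot>\<^sub>m ((0\<^sub>m (m 2 * m 3) (m 2 * m 3) @\<^sub>r 1\<^sub>m (m 2 * m 3)) * flip (?x \<otimes>\<^sub>K 1\<^sub>m (m 3)))"
    unfolding u_hat_def k Let_def v_hat_eq[OF z(1,2) Ghc] Gam_hat flip_kronecker flip_one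
      flip_resolvent_row[OF z(2)] ..
  show ?thesis
    unfolding u uh
    by (rule u_reflection_core[OF toeplitz3_carrier R(1) flip_R R(3) M11_carrier M31_carrier M41_carrier
      toeplitz3_mult_M31 resolvent_rows_carrier[of \<mu> m, OF z(1,2)] E
      resolvent_rows_mult_M31[OF z(1,2) s(1)] c])
qed

lemma u_reflection_2:
  assumes \<mu>: "\<mu> 1 \<notin> {\<i>/2, -\<i>/2}" "\<mu> 2 \<notin> {\<i>/2, -\<i>/2}"
  shows "u m \<tau> 2 \<mu> = (- q m \<mu>) \<cdot>\<^sub>m (U m 3 * transpose_mat (u_hat m \<tau> 2 \<mu>) * Utilde m 1)"
proof -
  have z: "\<mu> 1 \<noteq> \<i>/2" "\<mu> 2 \<noteq> \<i>/2" "\<mu> 1 \<noteq> -\<i>/2" "\<mu> 2 \<noteq> -\<i>/2" using \<mu> by auto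
  have k: "3 - 2 = (1 :: nat)" by simp
  have Gam: "Gam m \<tau> 2 = R * (M12 m \<tau> @\<^sub>c M32 m)" by (simp add: Gam_def Pi_mat_def)
  have Gam_hat: "Gam_hat m \<tau> 2 = (flip (M32 m) @\<^sub>r M42 m \<tau>) * R"
    by (simp add: Gam_hat_def Pi_hat_def M22_eq)
  have Gc: "Gam m \<tau> 2 \<in> carrier_mat n (m 1 * m 3 + m 1 * m 3)"
    unfolding Gam by (rule mult_carrier_mat[OF R(1)]) simp
  have Ghc: "Gam_hat m \<tau> 2 \<in> carrier_mat (m 1 * m 3 + m 1 * m 3) n"
    unfolding Gam_hat by (rule mult_carrier_mat[OF _ R(1)]) simp
  let ?x = "resolvent_row m 1 (\<mu> 1)"
  have E: "?x \<otimes>\<^sub>K 1\<^sub>m (m 3) \<in> carrier_mat (m 3) (m 1 * m 3)"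
    using kronecker_carrier[OF resolvent_row_carrier[OF z(1), of m 1] one_carrier_mat[of "m 3"]] by simp
  obtain s where s: "resolvent_row m 2 (\<mu> 2) * ones_col (m 2) = s \<cdot>\<^sub>m 1\<^sub>m 1"
    "1 - \<i> * s = ((\<mu> 2 + \<i>/2) / (\<mu> 2 - \<i>/2)) ^ m 2"
    using resolvent_row_mult_ones[OF z(2)] .
  have nz: "\<mu> 2 - \<i>/2 \<noteq> 0" "\<mu> 2 + \<i>/2 \<noteq> 0" using z add_half_imaginary_unit_nonzero by auto
  then have c: "cayley_power m 1 (\<mu> 1) = q m \<mu> * (1 - \<i> * s)"
    unfolding s q_def cayley_power_def by (simp add: power_divide)
  have u: "u m \<tau> 2 \<mu> = q m \<mu> \<cdot>\<^sub>m (resolvent_rows m \<mu> * (R * (M12 m \<tau> @\<^sub>c M32 m))) -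
      \<i> \<cdot>\<^sub>m ((cayley_power m 1 (\<mu> 1) \<cdot>\<^sub>m (?x \<otimes>\<^sub>K 1\<^sub>m (m 3))) *
        (1\<^sub>m (m 1 * m 3) @\<^sub>c 0\<^sub>m (m 1 * m 3) (m 1 * m 3)))"
    unfolding u_def k Let_def v_eq[OF \<mu> Gc] Gam adjoint_resolvent_row[OF z(1,3)] kronecker_smult_left ..
  have uh: "u_hat m \<tau> 2 \<mu> = (flip (M32 m) @\<^sub>r M42 m \<tau>) * R * flip (resolvent_rows m \<mu>) +
      \<i> \<cdot>\<^sub>m ((0\<^sub>m (m 1 * m 3) (m 1 * m 3) @\<^sub>r 1\<^sub>m (m 1 * m 3)) * flip (?x \<otimes>\<^sub>K 1\<^sub>m (m 3)))"
    unfolding u_hat_def k Let_def v_hat_eq[OF z(1,2) Ghc] Gam_hat flip_kronecker flip_one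
      flip_resolvent_row[OF z(1)] ..
  show ?thesis
    unfolding u uh
    by (rule u_reflection_core[OF toeplitz3_carrier R(1) flip_R R(3) M12_carrier M32_carrier M42_carrier
      toeplitz3_mult_M32 resolvent_rows_carrier[of \<mu> m, OF z(1,2)] E
      resolvent_rows_mult_M32[OF z(1,2) s(1)] c])
qed


lemma flip_M12_R: "flip (M12 m \<tau>) * R = M22 m - M42 m \<tau> * R"
proof -
  let ?T = "toeplitz3 m \<tau>"
  have fM: "flip (M12 m \<tau>) \<in> carrier_mat (m 1 * m 3) n" by simp
  have "M22 m * ?T = flip (?T * M32 m)"
    by (simp add: flip_mult[OF toeplitz3_carrier M32_carrier] M22_eq flip_toeplitz3)
  also have "\<dots> = flip (M12 m \<tau>) + M42 m \<tau>"
    by (simp add: toeplitz3_mult_M32 flip_add[of _ n "m 1 * m 3"])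
  finally have "(M22 m * ?T) * R = flip (M12 m \<tau>) * R + M42 m \<tau> * R"
    using R by (simp add: add_mult_distrib_mat[OF fM M42_carrier])
  moreover have "(M22 m * ?T) * R = M22 m"
    unfolding assoc_mult_mat[OF M22_carrier toeplitz3_carrier R(1)] R(2)
    by (rule right_mult_one_mat[OF M22_carrier])
  moreover have "M42 m \<tau> * R \<in> carrier_mat (m 1 * m 3) n" "flip (M12 m \<tau>) * R \<in> carrier_mat (m 1 * m 3) n"
    using R(1) by (auto intro!: mult_carrier_mat)
  ultimately show ?thesis by (metis eq_minus_if_eq_add)
qed

lemma R_flip_M41: "R * flip (M41 m \<tau>) = M31 m - R * M11 m \<tau>"
proof -
  let ?T = "toeplitz3 m \<tau>"
  have fM: "flip (M41 m \<tau>) \<in> carrier_mat n (m 2 * m 3)" by simp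
  have "M31 m = R * (?T * M31 m)"
    unfolding assoc_mult_mat[OF R(1) toeplitz3_carrier M31_carrier, symmetric] R(3)
    by (rule left_mult_one_mat[OF M31_carrier, symmetric])
  also have "\<dots> = R * M11 m \<tau> + R * flip (M41 m \<tau>)"
    unfolding toeplitz3_mult_M31 by (rule mult_add_distrib_mat[OF R(1) M11_carrier fM])
  finally have "M31 m = R * M11 m \<tau> + R * flip (M41 m \<tau>)" .
  moreover have "R * M11 m \<tau> \<in> carrier_mat n (m 2 * m 3)" "R * flip (M41 m \<tau>) \<in> carrier_mat n (m 2 * m 3)"
    using R(1) fM by (auto intro!: mult_carrier_mat)
  ultimately show ?thesis by (metis eq_minus_if_eq_add comm_add_mat)
qed

text \<open>The four blocks of \<open>G_12\<close> are reflected one by one. Each block of \<open>G_12\<close> contains \<open>R\<close> between two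
data matrices, and \<open>flip_M12_R\<close> and \<open>R_flip_M41\<close> replace the reflected data matrices by the ones that
occur in \<open>G_21\<close>. The explicit term \<open>M_22 M_31 = L_1 L_2\<^sup>*\<close> that this creates cancels the constant
subtracted in the upper left block of \<open>G_12\<close> and becomes the one subtracted in the upper left block
of \<open>G_21\<close>; for the lower left block, \<open>K11_decomposition\<close> turns \<open>K_12\<close> into \<open>K_11\<close>.\<close>

lemma G21_reflection: "G21 m \<tau> = Utilde m 1 * transpose_mat (G12 m \<tau>) * Utilde m 2"
proof -
  define N1 where "N1 = m 1 * m 3"
  define N2 where "N2 = m 2 * m 3"
  let ?LL = "Lp m 1 * mat_adjoint (Lp m 2)" and ?LL' = "Lp m 2 * mat_adjoint (Lp m 1)"
  note M1 = M11_carrier[of m \<tau>, folded N2_def] M31_carrier[of m, folded N2_def]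
    M21_carrier[of m, folded N2_def] M41_carrier[of m \<tau>, folded N2_def]
  note M2 = M12_carrier[of m \<tau>, folded N1_def N2_def] M32_carrier[of m, folded N1_def N2_def]
    M22_carrier[of m, folded N1_def N2_def] M42_carrier[of m \<tau>, folded N1_def N2_def]
  note K = K11_carrier[of m \<tau>, folded N1_def N2_def] K12_carrier[of m \<tau>, folded N1_def N2_def]
  note Rc = R(1)[folded N2_def]
  note RM = mult_carrier_mat[OF Rc M1(1)] mult_carrier_mat[OF Rc M1(2)]
    mult_carrier_mat[OF Rc M2(1)] mult_carrier_mat[OF Rc M2(2)]
  note LL = Lp_mult_adjoint_carrier[of m 1 2, folded N1_def N2_def]
    Lp_mult_adjoint_carrier[of m 2 1, folded N1_def N2_def]
  let ?a = "M21 m * (R * M12 m \<tau>)" and ?b = "M21 m * (R * M32 m)"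
  let ?c = "M41 m \<tau> * (R * M12 m \<tau>)" and ?d = "M41 m \<tau> * (R * M32 m)"
  let ?a' = "M22 m * (R * M11 m \<tau>)" and ?b' = "M22 m * (R * M31 m)"
  let ?c' = "M42 m \<tau> * (R * M11 m \<tau>)" and ?d' = "M42 m \<tau> * (R * M31 m)"
  note abcd = mult_carrier_mat[OF M1(3) RM(3)] mult_carrier_mat[OF M1(3) RM(4)]
    mult_carrier_mat[OF M1(4) RM(3)] mult_carrier_mat[OF M1(4) RM(4)]
  note abcd' = mult_carrier_mat[OF M2(3) RM(1)] mult_carrier_mat[OF M2(3) RM(2)]
    mult_carrier_mat[OF M2(4) RM(1)] mult_carrier_mat[OF M2(4) RM(2)]
  note LL_eq = M22_mult_M31[of m]
  have fRM12: "flip (R * M12 m \<tau>) = M22 m - M42 m \<tau> * R"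
    using flip_mult[OF Rc M2(1)] by (simp add: flip_R flip_M12_R)
  have M42R: "M42 m \<tau> * R \<in> carrier_mat N1 (m 1 * N2)" by (rule mult_carrier_mat[OF M2(4) Rc])
  have a: "flip (?a - ?LL') = - ?d'"
  proof -
    have "flip ?a = (M22 m - M42 m \<tau> * R) * M31 m"
      using flip_mult[OF M1(3) RM(3)] by (simp add: fRM12 M21_eq)
    also have "\<dots> = ?LL - ?d'"
      unfolding minus_mult_distrib_mat[OF M2(3) M42R M1(2)] LL_eq assoc_mult_mat[OF M2(4) Rc M1(2)] ..
    finally have "flip (?a - ?LL') = (?LL - ?d') - ?LL"
      by (simp add: flip_minus[OF abcd(1) LL(2)] flip_Lp_mult_adjoint)
    then show ?thesis by (simp only: minus_minus_cancel[OF LL(1) abcd'(4)])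
  qed
  have d: "flip ?d = ?LL - ?a'"
  proof -
    have "flip ?d = (M22 m * R) * flip (M41 m \<tau>)"
      using flip_mult[OF M1(4) RM(4)] flip_mult[OF Rc M2(2)] by (simp add: flip_R M22_eq)
    also have "\<dots> = M22 m * (M31 m - R * M11 m \<tau>)"
      using assoc_mult_mat[OF M2(3) Rc flip_carrier[OF M1(4)]] by (simp add: R_flip_M41)
    also have "\<dots> = ?LL - ?a'"
      unfolding mult_minus_distrib_mat[OF M2(3) M1(2) RM(1)] LL_eq ..
    finally show ?thesis .
  qed
  have b: "flip ?b = ?b'"
    using flip_mult[OF M1(3) RM(4)] flip_mult[OF Rc M2(2)] assoc_mult_mat[OF M2(3) Rc M1(2)]
    by (simp add: flip_R M22_eq M21_eq)
  have c: "flip (?c - K12 m \<tau>) = ?c' - K11 m \<tau>"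
  proof -
    obtain E where E: "E \<in> carrier_mat N2 N1"
      "M42 m \<tau> * M31 m = K11 m \<tau> + flip E" "M41 m \<tau> * M32 m = K12 m \<tau> + E"
      using K11_decomposition[of m \<tau>, folded N1_def N2_def] by blast
    have "flip ?c = (M22 m - M42 m \<tau> * R) * flip (M41 m \<tau>)"
      using flip_mult[OF M1(4) RM(3)] by (simp add: fRM12)
    also have "\<dots> = M22 m * flip (M41 m \<tau>) - M42 m \<tau> * (M31 m - R * M11 m \<tau>)"
      unfolding minus_mult_distrib_mat[OF M2(3) M42R flip_carrier[OF M1(4)]]
        assoc_mult_mat[OF M2(4) Rc flip_carrier[OF M1(4)]] R_flip_M41 ..
    also have "M22 m * flip (M41 m \<tau>) = flip (K12 m \<tau>) + flip E"
      using flip_mult[OF M1(4) M2(2)] by (simp add: E flip_add[OF K(2) E(1)] M22_eq)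
    also have "M42 m \<tau> * (M31 m - R * M11 m \<tau>) = K11 m \<tau> + flip E - ?c'"
      unfolding mult_minus_distrib_mat[OF M2(4) M1(2) RM(1)] E ..
    finally have "flip (?c - K12 m \<tau>) =
        flip (K12 m \<tau>) + flip E - (K11 m \<tau> + flip E - ?c') - flip (K12 m \<tau>)"
      by (simp add: flip_minus[OF abcd(3) K(2)])
    then show ?thesis
      by (simp only: add_minus_cancel[OF flip_carrier[OF K(2)] flip_carrier[OF E(1)] K(1) abcd'(3)])
  qed
  let ?F = "four_block_mat (?a - ?LL') ?b (?c - K12 m \<tau>) ?d"
  have F: "?F \<in> carrier_mat (N2 + N2) (N1 + N1)"
    using abcd LL K by (intro four_block_carrier_mat minus_carrier_mat) auto
  have G12: "G12 m \<tau> = \<i> \<cdot>\<^sub>m ?F"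
    unfolding G12_def Let_def Gam_def Pi_hat_def Pi_mat_def N1_def[symmetric] N2_def[symmetric]
    using append_rows_mult_append_cols[OF M1(3,4) RM(3,4)] mult_append_cols[OF Rc M2(1,2)]
      four_block_minus_left_column[OF abcd LL(2) K(2)]
    by simp
  have G21: "G21 m \<tau> = \<i> \<cdot>\<^sub>m four_block_mat (?a' - ?LL) ?b' (?c' - K11 m \<tau>) ?d'"
    unfolding G21_def Let_def Gam_def Pi_hat_def Pi_mat_def N1_def[symmetric] N2_def[symmetric]
    using append_rows_mult_append_cols[OF M2(3,4) RM(1,2)] mult_append_cols[OF Rc M1(1,2)]
      four_block_minus_left_column[OF abcd' LL(1) K(1)]
    by simp
  have U: "Utilde m 1 \<in> carrier_mat (N1 + N1) (N1 + N1)" "Utilde m 2 \<in> carrier_mat (N2 + N2) (N2 + N2)"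
    unfolding Utilde_eq_exchange N1_def[symmetric] N2_def[symmetric]
    by (intro four_block_carrier_mat; simp)+
  have Ft: "transpose_mat ?F \<in> carrier_mat (N1 + N1) (N2 + N2)" using F by simp
  have "Utilde m 1 * transpose_mat (G12 m \<tau>) * Utilde m 2 =
      \<i> \<cdot>\<^sub>m (Utilde m 1 * transpose_mat ?F * Utilde m 2)"
    unfolding G12 transpose_mat_smult mult_smult_distrib[OF U(1) Ft]
      mult_smult_assoc_mat[OF mult_carrier_mat[OF U(1) Ft] U(2)] ..
  also have "Utilde m 1 * transpose_mat ?F * Utilde m 2 =
      four_block_mat (- flip ?d) (flip ?b) (flip (?c - K12 m \<tau>)) (- flip (?a - ?LL'))"
    by (rule Utilde_transpose_Utilde[where m = m, folded N1_def N2_def,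
      OF minus_carrier_mat[OF LL(2)] abcd(2) minus_carrier_mat[OF K(2)] abcd(4)])
  also have "- flip ?d = ?a' - ?LL"
    unfolding d by (rule uminus_minus[OF LL(1) abcd'(1)])
  finally show ?thesis unfolding G21 by (simp add: a b c)
qed

end

theorem corollary4p4:
  fixes m :: "nat \<Rightarrow> nat"
  assumes "m 1 \<ge> 2" and "m 2 \<ge> 2" and "m 3 \<ge> 2"
  shows "(\<forall>\<tau> :: int \<Rightarrow> int \<Rightarrow> int \<Rightarrow> complex. invertible_mat (toeplitz3 m \<tau>) \<longrightarrow>
           (\<forall>k\<in>{1, 2}. \<forall>p\<in>{1, 2}. k \<noteq> p \<longrightarrow>
             (\<forall>\<mu> :: nat \<Rightarrow> complex. \<mu> 1 \<notin> {\<i>/2, -\<i>/2} \<and> \<mu> 2 \<notin> {\<i>/2, -\<i>/2} \<longrightarrow>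
               u m \<tau> p \<mu> = (- q m \<mu>) \<cdot>\<^sub>m (U m 3 * transpose_mat (u_hat m \<tau> p \<mu>) * Utilde m k))))
    \<and> (\<exists>F. \<forall>\<tau> :: int \<Rightarrow> int \<Rightarrow> int \<Rightarrow> complex. invertible_mat (toeplitz3 m \<tau>) \<longrightarrow>
           (\<forall>\<mu> :: nat \<Rightarrow> complex. G m \<tau> \<mu> = F (G12 m \<tau>) \<mu>))
    \<and> (\<forall>\<tau> :: int \<Rightarrow> int \<Rightarrow> int \<Rightarrow> complex. invertible_mat (toeplitz3 m \<tau>) \<longrightarrow>
           G21 m \<tau> = Utilde m 1 * transpose_mat (G12 m \<tau>) * Utilde m 2)"
proof (intro conjI)
  show "\<forall>\<tau>. invertible_mat (toeplitz3 m \<tau>) \<longrightarrow>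
      (\<forall>k\<in>{1, 2}. \<forall>p\<in>{1, 2}. k \<noteq> p \<longrightarrow>
        (\<forall>\<mu>. \<mu> 1 \<notin> {\<i>/2, -\<i>/2} \<and> \<mu> 2 \<notin> {\<i>/2, -\<i>/2} \<longrightarrow>
          u m \<tau> p \<mu> = (- q m \<mu>) \<cdot>\<^sub>m (U m 3 * transpose_mat (u_hat m \<tau> p \<mu>) * Utilde m k)))"
    using u_reflection_1 u_reflection_2 by blast
  show "\<forall>\<tau>. invertible_mat (toeplitz3 m \<tau>) \<longrightarrow>
      G21 m \<tau> = Utilde m 1 * transpose_mat (G12 m \<tau>) * Utilde m 2"
    using G21_reflection by blast
  then show "\<exists>F. \<forall>\<tau>. invertible_mat (toeplitz3 m \<tau>) \<longrightarrow> (\<forall>\<mu>. G m \<tau> \<mu> = F (G12 m \<tau>) \<mu>)"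
    by (intro exI[of _ "\<lambda>X \<mu>. four_block_mat (G11 m \<mu>) X
        (Utilde m 1 * transpose_mat X * Utilde m 2) (G22 m \<mu>)"]) (simp add: G_def)
qed

end
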